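(* Let $\ell_1,\ell_2\ge 2$ be integers and fix $L>0$. Let $\overline{\mathcal H}_0=\mathcal P'_{0,[0,1]}$, let $\mathcal H_0$ be any one of $\mathcal P'_{0,[0,1],\mathrm{TV}}(L)$, $\mathcal P'_{0,[0,1],\mathrm{TV}^2}(L)$, $\mathcal P'_{0,[0,1],\chi^2}(L)$, and let $\mathcal H_1=\mathcal Q'_{0,[0,1],\mathrm{TV}}(L)$. Then there is a constant $c_0>0$, not depending on $n,\ell_1,\ell_2$ ($L$ being fixed), such that for all $n\ge 1$ the critical radius satisfies $$\varepsilon_n(\mathcal H_0,\overline{\mathcal H}_0,\mathcal H_1)\ \ge\ c_0\left(\frac{(\ell_1\ell_2)^{1/5}}{n^{2/5}}\wedge 1\right).$$
   Context: Notation: $[\ell]=\{1,\dots,\ell\}$; $a\wedge b=\min(a,b)$; for distributions $p,q$ with densities with respect to a common dominating measure $\nu$, $\|p-q\|_1=\int|\frac{dp}{d\nu}-\frac{dq}{d\nu}|d\nu$ (twice the total variation distance); $d_{\chi^2}(p,q)=\int(\frac{dp}{dq}-1)^2dq$ if $p\ll q$, and $d_{\chi^2}(p,q)=\infty$ otherwise. $\mathcal E'_{0,[0,1]}$ is the set of distributions $p=p_{X,Y,Z}$ of triples $(X,Y,Z)$ such that $Z$ has a distribution $p_Z$ supported on $[0,1]$ and absolutely continuous with respect to Lebesgue measure, and for almost all $z$ the conditional distribution $p_{X,Y|Z=z}$ is supported on $[\ell_1]\times[\ell_2]$. $\mathcal P'_{0,[0,1]}\subset\mathcal E'_{0,[0,1]}$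 is the subset of distributions with $X$ and $Y$ conditionally independent given $Z$, and $\mathcal Q'_{0,[0,1]}=\mathcal E'_{0,[0,1]}\setminus\mathcal P'_{0,[0,1]}$. Conditions below on conditional distributions at every $z$ refer to a suitable version of the conditional distributions. - $\mathcal P'_{0,[0,1],\mathrm{TV}}(L)$: those $p\in\mathcal P'_{0,[0,1]}$ with $\|p_{X|Z=z}-p_{X|Z=z'}\|_1\le L|z-z'|$ and $\|p_{Y|Z=z}-p_{Y|Z=z'}\|_1\le L|z-z'|$ for all $z,z'\in[0,1]$. - $\mathcal P'_{0,[0,1],\chi^2}(L)$: those $p\in\mathcal P'_{0,[0,1]}$ with $d_{\chi^2}(p_{X|Z=z},p_{X|Z=z'})\le L|z-z'|$ and $d_{\chi^2}(p_{Y|Z=z},p_{Y|Z=z'})\le L|z-z'|$ for all $z,z'\in[0,1]$. - $\mathcal P'_{0,[0,1],\mathrm{TV}^2}(L)$: those $p\in\mathcal P'_{0,[0,1]}$ with $\|p_{X|Z=z}-p_{X|Z=z'}\|_1\le \sqrt{L|z-z'|}$ and $\|p_{Y|Z=z}-p_{Y|Z=z'}\|_1\le \sqrt{L|z-z'|}$ for all $z,z'\in[0,1]$. - $\mathcal Q'_{0,[0,1],\mathrm{TV}}(L)$: those $p\in\mathcal Q'_{0,[0,1]}$ with $\|p_{X,Y|Z=z}-p_{X,Y|Z=z'}\|_1\le L|z-z'|$ for all $z,z'\in[0,1]$. Minimax testing: for sets of distributions $\mathcal H_0\subseteq\overline{\mathcal H}_0$ and $\mathcal H_1$, let $\mathcal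 S_1(\varepsilon)=\{p\in\mathcal H_1:\inf_{q\in\overline{\mathcal H}_0}\|p-q\|_1\ge\varepsilon\}$ and $$R_n(\mathcal H_0,\overline{\mathcal H}_0,\mathcal H_1,\varepsilon)=\inf_\psi\Big\{\sup_{p\in\mathcal H_0}\mathbb E_p[\psi(\mathcal D_n)]+\sup_{p\in\mathcal S_1(\varepsilon)}\mathbb E_p[1-\psi(\mathcal D_n)]\Big\},$$ where $\mathcal D_n$ consists of $n$ i.i.d. observations $(X_i,Y_i,Z_i)\sim p$, the infimum is over all Borel measurable test functions $\psi$ of the data with values in $[0,1]$, and a supremum over the empty set is $0$. The critical radius is $\varepsilon_n(\mathcal H_0,\overline{\mathcal H}_0,\mathcal H_1)=\inf\{\varepsilon: R_n(\mathcal H_0,\overline{\mathcal H}_0,\mathcal H_1,\varepsilon)\le \tfrac13\}$. *)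

theory Defs
  imports "HOL-Probability.Probability"
begin

section \<open>Distances between distributions\<close>

text \<open>
  All distances, risks and radii take values in \<^typ>\<open>ennreal\<close>, where every supremum and infimum
  exists and the supremum of the empty set is 0.
\<close>

definition add_measure :: "'a measure \<Rightarrow> 'a measure \<Rightarrow> 'a measure" where
  "add_measure p q = measure_of (space p) (sets p) (\<lambda>A. emeasure p A + emeasure q A)"

text \<open>
  The $L_1$ distance is computed with the dominating measure $p + q$; lemma \<open>l1_dist_density\<close> below
  shows that any other dominating measure gives the same value.
\<close>

definition l1_dist :: "'a measure \<Rightarrow> 'a measure \<Rightarrow> ennreal" where
  "l1_dist p q = (let \<nu> = add_measure p q in
     \<integral>\<^sup>+ x. ennreal \<bar>enn2real (RN_deriv \<nu> p x) - enn2real (RN_deriv \<nu> q x)\<bar> \<partial>\<nu>)"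

text \<open>\<^term>\<open>absolutely_continuous q p\<close> means that $p$ is dominated by $q$.\<close>

definition chi2_div :: "'a measure \<Rightarrow> 'a measure \<Rightarrow> ennreal" where
  "chi2_div p q = (if absolutely_continuous q p
     then \<integral>\<^sup>+ x. ennreal ((enn2real (RN_deriv q p x) - 1)\<^sup>2) \<partial>q else \<infinity>)"

lemma add_measure_density:
  assumes [measurable]: "f \<in> borel_measurable \<nu>" "g \<in> borel_measurable \<nu>"
  shows "add_measure (density \<nu> f) (density \<nu> g) = density \<nu> (\<lambda>x. f x + g x)"
proof -
  have "add_measure (density \<nu> f) (density \<nu> g)
      = measure_of (space \<nu>) (sets \<nu>) (emeasure (density \<nu> (\<lambda>x. f x + g x)))"
    unfolding add_measure_def
    by (rule trans[OF measure_of_eq[of _ _ _ "emeasure (density \<nu> (\<lambda>x. f x + g x))"]])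
       (auto simp: sets.space_closed sets.sigma_sets_eq emeasure_density_add)
  also have "\<dots> = density \<nu> (\<lambda>x. f x + g x)"
    using measure_of_of_measure[of "density \<nu> (\<lambda>x. f x + g x)"] by simp
  finally show ?thesis .
qed

lemma l1_dist_density:
  fixes f g :: "'a \<Rightarrow> real"
  assumes [measurable]: "f \<in> borel_measurable \<nu>" "g \<in> borel_measurable \<nu>"
    and nonneg: "\<And>x. f x \<ge> 0" "\<And>x. g x \<ge> 0"
    and p: "p = density \<nu> f" "prob_space p" and q: "q = density \<nu> g" "prob_space q"
  shows "l1_dist p q = (\<integral>\<^sup>+ x. ennreal \<bar>f x - g x\<bar> \<partial>\<nu>)"
proof -
  define h where "h x = f x + g x" for x
  have [measurable]: "h \<in> borel_measurable \<nu>" unfolding h_def by simp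
  have h0: "h x \<ge> 0" for x using nonneg by (simp add: h_def)
  define S where "S = density \<nu> h"
  have S: "add_measure p q = S"
    using nonneg unfolding p q S_def h_def by (simp add: add_measure_density)
  have "emeasure S (space S) = emeasure p (space p) + emeasure q (space q)"
    using emeasure_density_add[of "space \<nu>" \<nu> f g] nonneg
    unfolding S_def p q h_def by simp
  also have "\<dots> = 2" using prob_space.emeasure_space_1[OF p(2)] prob_space.emeasure_space_1[OF q(2)] by simp
  finally interpret S: finite_measure S by (intro finite_measureI) simp
  have dens: "AE x in S. RN_deriv S (density \<nu> k) x = ennreal (k x / h x)"
    if [measurable]: "k \<in> borel_measurable \<nu>" and k: "\<And>x. 0 \<le> k x" "\<And>x. k x \<le> h x" for k :: "'a \<Rightarrow> real"
  proof -
    have "density S (\<lambda>x. ennreal (k x / h x)) = density \<nu> (\<lambda>x. ennreal (h x) * ennreal (k x / h x))"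
      unfolding S_def by (rule density_density_eq) auto
    also have "(\<lambda>x. ennreal (h x) * ennreal (k x / h x)) = (\<lambda>x. ennreal (k x))"
    proof
      fix x show "ennreal (h x) * ennreal (k x / h x) = ennreal (k x)"
        using k[of x] h0[of x] by (cases "h x = 0") (auto simp: ennreal_mult[symmetric])
    qed
    finally have "density S (\<lambda>x. ennreal (k x / h x)) = density \<nu> k" .
    moreover have "(\<lambda>x. ennreal (k x / h x)) \<in> borel_measurable S" unfolding S_def by simp
    ultimately show ?thesis using S.RN_deriv_unique by force
  qed
  have "l1_dist p q = (\<integral>\<^sup>+ x. ennreal \<bar>f x / h x - g x / h x\<bar> \<partial>S)"
    unfolding l1_dist_def Let_def S
    using dens[of f] dens[of g] nonneg h0
    by (intro nn_integral_cong_AE) (auto simp: p q h_def)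
  also have "\<dots> = (\<integral>\<^sup>+ x. ennreal (h x) * ennreal \<bar>f x / h x - g x / h x\<bar> \<partial>\<nu>)"
    unfolding S_def by (rule nn_integral_density) auto
  also have "\<dots> = (\<integral>\<^sup>+ x. ennreal \<bar>f x - g x\<bar> \<partial>\<nu>)"
  proof (rule nn_integral_cong)
    fix x
    have "h x * \<bar>f x / h x - g x / h x\<bar> = \<bar>f x - g x\<bar>"
    proof (cases "h x = 0")
      case True
      then have "f x = 0" "g x = 0" using nonneg[of x] by (auto simp: h_def)
      then show ?thesis by simp
    next
      case False
      then show ?thesis using h0[of x] by (simp add: diff_divide_distrib[symmetric])
    qed
    then show "ennreal (h x) * ennreal \<bar>f x / h x - g x / h x\<bar> = ennreal \<bar>f x - g x\<bar>"
      using h0[of x] by (simp add: ennreal_mult[symmetric])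
  qed
  finally show ?thesis .
qed


section \<open>Distributions of triples $(X,Y,Z)$\<close>

abbreviation obs_space :: "(nat \<times> nat \<times> real) measure" where
  "obs_space \<equiv> count_space UNIV \<Otimes>\<^sub>M (count_space UNIV \<Otimes>\<^sub>M borel)"

definition Z_law :: "(nat \<times> nat \<times> real) measure \<Rightarrow> real measure" where
  "Z_law p = distr p borel (\<lambda>(x, y, z). z)"

text \<open>
  \<open>cond_version p \<kappa>\<close>: the kernel \<open>\<kappa>\<close> is a version of the regular conditional distribution of
  $(X,Y)$ given $Z$ under $p$.  A member of one of the smoothness classes only has to admit some
  version that satisfies the smoothness condition at all points of $[0,1]$.
\<close>

definition cond_version ::
    "(nat \<times> nat \<times> real) measure \<Rightarrow> (real \<Rightarrow> (nat \<times> nat) pmf) \<Rightarrow> bool" where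
  "cond_version p \<kappa> \<longleftrightarrow>
     (\<lambda>z. measure_pmf (\<kappa> z)) \<in> borel \<rightarrow>\<^sub>M prob_algebra (count_space UNIV) \<and>
     (\<forall>A. \<forall>B\<in>sets borel. emeasure p {(x, y, z). (x, y) \<in> A \<and> z \<in> B} =
        (\<integral>\<^sup>+ z\<in>B. emeasure (measure_pmf (\<kappa> z)) A \<partial>Z_law p))"

definition E01 :: "nat \<Rightarrow> nat \<Rightarrow> (nat \<times> nat \<times> real) measure set" where
  "E01 l1 l2 = {p. prob_space p \<and> sets p = sets obs_space \<and>
     (AE z in Z_law p. z \<in> {0..1}) \<and> absolutely_continuous lborel (Z_law p) \<and>
     (\<exists>\<kappa>. cond_version p \<kappa> \<and> (AE z in Z_law p. set_pmf (\<kappa> z) \<subseteq> {1..l1} \<times> {1..l2}))}"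

definition P01 :: "nat \<Rightarrow> nat \<Rightarrow> (nat \<times> nat \<times> real) measure set" where
  "P01 l1 l2 = {p \<in> E01 l1 l2. \<exists>\<kappa>. cond_version p \<kappa> \<and>
     (AE z in Z_law p. prob_space.indep_var (measure_pmf (\<kappa> z))
        (count_space UNIV) fst (count_space UNIV) snd)}"

definition Q01 :: "nat \<Rightarrow> nat \<Rightarrow> (nat \<times> nat \<times> real) measure set" where
  "Q01 l1 l2 = E01 l1 l2 - P01 l1 l2"

definition P01_TV :: "real \<Rightarrow> nat \<Rightarrow> nat \<Rightarrow> (nat \<times> nat \<times> real) measure set" where
  "P01_TV L l1 l2 = {p \<in> P01 l1 l2. \<exists>\<kappa>. cond_version p \<kappa> \<and> (\<forall>z\<in>{0..1}. \<forall>z'\<in>{0..1}.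
     l1_dist (map_pmf fst (\<kappa> z)) (map_pmf fst (\<kappa> z')) \<le> ennreal (L * \<bar>z - z'\<bar>) \<and>
     l1_dist (map_pmf snd (\<kappa> z)) (map_pmf snd (\<kappa> z')) \<le> ennreal (L * \<bar>z - z'\<bar>))}"

definition P01_chi2 :: "real \<Rightarrow> nat \<Rightarrow> nat \<Rightarrow> (nat \<times> nat \<times> real) measure set" where
  "P01_chi2 L l1 l2 = {p \<in> P01 l1 l2. \<exists>\<kappa>. cond_version p \<kappa> \<and> (\<forall>z\<in>{0..1}. \<forall>z'\<in>{0..1}.
     chi2_div (map_pmf fst (\<kappa> z)) (map_pmf fst (\<kappa> z')) \<le> ennreal (L * \<bar>z - z'\<bar>) \<and>
     chi2_div (map_pmf snd (\<kappa> z)) (map_pmf snd (\<kappa> z')) \<le> ennreal (L * \<bar>z - z'\<bar>))}"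

definition P01_TV2 :: "real \<Rightarrow> nat \<Rightarrow> nat \<Rightarrow> (nat \<times> nat \<times> real) measure set" where
  "P01_TV2 L l1 l2 = {p \<in> P01 l1 l2. \<exists>\<kappa>. cond_version p \<kappa> \<and> (\<forall>z\<in>{0..1}. \<forall>z'\<in>{0..1}.
     l1_dist (map_pmf fst (\<kappa> z)) (map_pmf fst (\<kappa> z')) \<le> ennreal (sqrt (L * \<bar>z - z'\<bar>)) \<and>
     l1_dist (map_pmf snd (\<kappa> z)) (map_pmf snd (\<kappa> z')) \<le> ennreal (sqrt (L * \<bar>z - z'\<bar>)))}"

definition Q01_TV :: "real \<Rightarrow> nat \<Rightarrow> nat \<Rightarrow> (nat \<times> nat \<times> real) measure set" where
  "Q01_TV L l1 l2 = {p \<in> Q01 l1 l2. \<exists>\<kappa>. cond_version p \<kappa> \<and> (\<forall>z\<in>{0..1}. \<forall>z'\<in>{0..1}.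
     l1_dist (\<kappa> z) (\<kappa> z') \<le> ennreal (L * \<bar>z - z'\<bar>))}"


section \<open>Minimax testing\<close>

type_synonym data = "nat \<Rightarrow> nat \<times> nat \<times> real"

definition sample_law :: "nat \<Rightarrow> (nat \<times> nat \<times> real) measure \<Rightarrow> data measure" where
  "sample_law n p = (\<Pi>\<^sub>M i\<in>{1..n}. p)"

definition tests :: "nat \<Rightarrow> (data \<Rightarrow> real) set" where
  "tests n = {\<psi> \<in> borel_measurable (\<Pi>\<^sub>M i\<in>{1..n}. obs_space). \<forall>D. \<psi> D \<in> {0..1}}"

definition separated ::
    "(nat \<times> nat \<times> real) measure set \<Rightarrow> (nat \<times> nat \<times> real) measure set \<Rightarrow> ennreal
      \<Rightarrow> (nat \<times> nat \<times> real) measure set" where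
  "separated H0bar H1 \<epsilon> = {p \<in> H1. (INF q\<in>H0bar. l1_dist p q) \<ge> \<epsilon>}"

definition minimax_risk ::
    "nat \<Rightarrow> (nat \<times> nat \<times> real) measure set \<Rightarrow> (nat \<times> nat \<times> real) measure set
      \<Rightarrow> (nat \<times> nat \<times> real) measure set \<Rightarrow> ennreal \<Rightarrow> ennreal" where
  "minimax_risk n H0 H0bar H1 \<epsilon> = (INF \<psi>\<in>tests n.
     (SUP p\<in>H0. \<integral>\<^sup>+ D. ennreal (\<psi> D) \<partial>sample_law n p) +
     (SUP p\<in>separated H0bar H1 \<epsilon>. \<integral>\<^sup>+ D. ennreal (1 - \<psi> D) \<partial>sample_law n p))"

definition critical_radius ::
    "nat \<Rightarrow> (nat \<times> nat \<times> real) measure set \<Rightarrow> (nat \<times> nat \<times> real) measure set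
      \<Rightarrow> (nat \<times> nat \<times> real) measure set \<Rightarrow> ennreal" where
  "critical_radius n H0 H0bar H1 = Inf {\<epsilon>. minimax_risk n H0 H0bar H1 \<epsilon> \<le> ennreal (1/3)}"

end

theory Submission
  imports Defs
begin

text \<open>
  Le Cam's method with the uniform law as null. Split $[0,1]$ into $d$ bins and $[\ell_1]\times[\ell_2]$
  into $2\times 2$ blocks; multiply the uniform density on each block by $1 \pm \eta\,\mathrm{tent}_j(z)$
  with sign pattern $(+,-;-,+)$ and an independent random sign for every block and bin $j$. Each
  alternative is Lipschitz in $z$, and at $L_1$ distance of order $1/d$ from conditional independence,
  because a $2\times 2$ block of a conditionally independent law is singular. The second moment of the
  averaged likelihood ratio is at most $\exp(n^2 / (8\,\ell_1\ell_2 d^5))$, so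
  $d \approx (n^2/(\ell_1\ell_2))^{1/5}$ bins cannot be told apart from the null.
\<close>

section \<open>Testing against a mixture\<close>

text \<open>A fixed perturbation would be found by a test matched to it. Independent signs prevent
  this: the correlation of two alternatives is a signed sum over cells, and averaging over the signs
  leaves only the squares of the cell terms. After n observations a cell term is at most n / (l1 l2
  d^3), where d^3 comes from the squared height of a tent times the width of its bin. There are at
  most l1 l2 d / 4 cells, and cell count times squared term gives the n^2 / (l1 l2 d^5) of the
  exponent. The separation must hold against every conditionally independent law, with any density
  of Z, not only against laws near the null. It is therefore proved pointwise in z for the joint
  densities: multiplying a conditional block by the density of Z keeps it singular. The null has a
  constant conditional law, so it lies in all three null classes and one argument serves them all.
  The slope \<open>\<eta>\<close> of the perturbation is at most 1 for positivity and at most L for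
  smoothness.\<close>

lemma PiM_density:
  fixes f :: "'a \<Rightarrow> ennreal"
  assumes "prob_space M" "prob_space (density M f)"
    and f [measurable]: "f \<in> borel_measurable M" and I: "finite I"
  shows "(\<Pi>\<^sub>M i\<in>I. density M f) = density (\<Pi>\<^sub>M i\<in>I. M) (\<lambda>x. \<Prod>i\<in>I. f (x i))"
proof -
  interpret M: prob_space M by fact
  interpret N: prob_space "density M f" by fact
  interpret PM: product_sigma_finite "\<lambda>_. M" ..
  interpret PN: product_sigma_finite "\<lambda>_. density M f" ..
  show ?thesis
  proof (rule PN.PiM_eqI[OF I, symmetric])
    show "sets (density (\<Pi>\<^sub>M i\<in>I. M) (\<lambda>x. \<Prod>i\<in>I. f (x i))) = sets (\<Pi>\<^sub>M i\<in>I. density M f)"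
      by (simp cong: sets_PiM_cong)
    fix A assume A: "\<And>i. i \<in> I \<Longrightarrow> A i \<in> sets (density M f)"
    then have [measurable]: "\<And>i. i \<in> I \<Longrightarrow> A i \<in> sets M" by simp
    have "emeasure (density (\<Pi>\<^sub>M i\<in>I. M) (\<lambda>x. \<Prod>i\<in>I. f (x i))) (Pi\<^sub>E I A)
        = (\<integral>\<^sup>+ x. (\<Prod>i\<in>I. f (x i)) * indicator (Pi\<^sub>E I A) x \<partial>(\<Pi>\<^sub>M i\<in>I. M))"
      by (rule emeasure_density) (use I in auto)
    also have "\<dots> = (\<integral>\<^sup>+ x. (\<Prod>i\<in>I. f (x i) * indicator (A i) (x i)) \<partial>(\<Pi>\<^sub>M i\<in>I. M))"
    proof (rule nn_integral_cong)
      \<comment> \<open>Membership in \<open>Pi\<^sub>E I A\<close> also demands the default value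
        off \<open>I\<close>, which every point of the product space has. Hence the indicator of the
        box factors over the coordinates.\<close>
      fix x assume "x \<in> space (\<Pi>\<^sub>M i\<in>I. M)"
      then have x: "x \<in> extensional I" by (auto simp: space_PiM PiE_def)
      show "(\<Prod>i\<in>I. f (x i)) * indicator (Pi\<^sub>E I A) x = (\<Prod>i\<in>I. f (x i) * indicator (A i) (x i))"
      proof (cases "\<forall>i\<in>I. x i \<in> A i")
        case True
        then show ?thesis using x by (auto simp: PiE_def Pi_def)
      next
        case False
        then show ?thesis using I by (auto simp: PiE_def Pi_def prod_zero_iff indicator_def)
      qed
    qed
    also have "\<dots> = (\<Prod>i\<in>I. \<integral>\<^sup>+ x. f x * indicator (A i) x \<partial>M)"
      by (rule PM.product_nn_integral_prod[OF I]) simp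
    also have "\<dots> = (\<Prod>i\<in>I. emeasure (density M f) (A i))"
      by (intro prod.cong refl) (simp add: emeasure_density)
    finally show "emeasure (density (\<Pi>\<^sub>M i\<in>I. M) (\<lambda>x. \<Prod>i\<in>I. f (x i))) (Pi\<^sub>E I A)
        = (\<Prod>i\<in>I. emeasure (density M f) (A i))" .
  qed
qed

text \<open>
  Le Cam's bound against the mixture $M = |W|^{-1} \sum_w \prod_i r_w(D_i)$: for $0 \le \psi \le 1$,
  $\psi + (1-\psi) M \ge \min(1,M) \ge M - M^2/4$, so only $E M = 1$ and $E M^2 \le 2$ are needed.
\<close>

lemma mixture_testing_bound:
  fixes r :: "'w \<Rightarrow> 'a \<Rightarrow> real" and \<psi> :: "(nat \<Rightarrow> 'a) \<Rightarrow> real"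
  assumes p0: "prob_space p0"
    and W: "finite W" "W \<noteq> {}"
    and r [measurable]: "\<And>w. w \<in> W \<Longrightarrow> r w \<in> borel_measurable p0"
    and r0: "\<And>w x. w \<in> W \<Longrightarrow> 0 \<le> r w x"
    and r1: "\<And>w. w \<in> W \<Longrightarrow> (\<integral>\<^sup>+ x. r w x \<partial>p0) = 1"
    and second: "(\<Sum>w\<in>W. \<Sum>w'\<in>W. (\<integral>\<^sup>+ x. ennreal (r w x * r w' x) \<partial>p0) ^ n) \<le> ennreal (2 * (real (card W))\<^sup>2)"
    and \<psi> [measurable]: "\<psi> \<in> borel_measurable (\<Pi>\<^sub>M i\<in>{1..n}. p0)"
    and \<psi>01: "\<And>D. \<psi> D \<in> {0..1}"
    and a: "(\<integral>\<^sup>+ D. \<psi> D \<partial>(\<Pi>\<^sub>M i\<in>{1..n}. p0)) \<le> a"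
    and b: "\<And>w. w \<in> W \<Longrightarrow> (\<integral>\<^sup>+ D. 1 - \<psi> D \<partial>(\<Pi>\<^sub>M i\<in>{1..n}. density p0 (r w))) \<le> b"
  shows "a + b \<ge> ennreal (1/2)"
proof -
  interpret p0: prob_space p0 by fact
  interpret PM: product_sigma_finite "\<lambda>_. p0" ..
  define P where "P = (\<Pi>\<^sub>M i\<in>{1..n}. p0)"
  define R where "R w D = (\<Prod>i\<in>{1..n}. r w (D i))" for w and D :: "nat \<Rightarrow> 'a"
  define N where "N = real (card W)"
  define M where "M D = (\<Sum>w\<in>W. R w D) / N" for D
  have N: "N > 0" using W by (simp add: N_def card_gt_0_iff)
  note \<psi>[folded P_def, measurable]
  have comp: "(\<lambda>D. D i) \<in> P \<rightarrow>\<^sub>M p0" if "i \<in> {1..n}" for i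
    unfolding P_def using that by simp
  have R [measurable]: "R w \<in> borel_measurable P" if "w \<in> W" for w
    unfolding R_def by (intro borel_measurable_prod measurable_compose[OF comp r] that)
  have M [measurable]: "M \<in> borel_measurable P"
    unfolding M_def using R by (intro borel_measurable_divide borel_measurable_sum) auto
  have R0: "0 \<le> R w D" if "w \<in> W" for w D
    unfolding R_def using that r0 by (intro prod_nonneg) auto
  have M0: "0 \<le> M D" for D unfolding M_def using R0 N by (intro divide_nonneg_pos sum_nonneg) auto
  have dens: "(\<Pi>\<^sub>M i\<in>{1..n}. density p0 (r w)) = density P (R w)" if w: "w \<in> W" for w
  proof -
    have "prob_space (density p0 (r w))"
      by (rule prob_spaceI) (use w r1 in \<open>simp add: emeasure_density nn_integral_indicator
        cong: nn_integral_cong_simp\<close>)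
    from PiM_density[OF p0 this _ finite_atLeastAtMost, of 1 n] w
    show ?thesis unfolding P_def R_def using r0 by (simp add: prod_ennreal)
  qed
  have R1: "(\<integral>\<^sup>+ D. R w D \<partial>P) = 1" if w: "w \<in> W" for w
  proof -
    have "(\<integral>\<^sup>+ D. R w D \<partial>P) = (\<integral>\<^sup>+ D. (\<Prod>i\<in>{1..n}. ennreal (r w (D i))) \<partial>P)"
      unfolding R_def using r0 w by (simp add: prod_ennreal)
    also have "\<dots> = (\<Prod>i\<in>{1..n}. \<integral>\<^sup>+ x. ennreal (r w x) \<partial>p0)"
      unfolding P_def using w by (intro PM.product_nn_integral_prod) auto
    finally show ?thesis using r1 w by simp
  qed
  have R2: "(\<integral>\<^sup>+ D. R w D * R w' D \<partial>P) = (\<integral>\<^sup>+ x. ennreal (r w x * r w' x) \<partial>p0) ^ n"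
    if w: "w \<in> W" "w' \<in> W" for w w'
  proof -
    have "(\<integral>\<^sup>+ D. R w D * R w' D \<partial>P) = (\<integral>\<^sup>+ D. (\<Prod>i\<in>{1..n}. ennreal (r w (D i) * r w' (D i))) \<partial>P)"
      unfolding R_def using r0 w by (simp add: prod_ennreal prod.distrib)
    also have "\<dots> = (\<Prod>i\<in>{1..n}. \<integral>\<^sup>+ x. ennreal (r w x * r w' x) \<partial>p0)"
      unfolding P_def using w by (intro PM.product_nn_integral_prod) auto
    finally show ?thesis by simp
  qed
  have avg: "(\<Sum>w\<in>W. ennreal (1/N)) = 1"
    using N W(2) by (simp add: N_def ennreal_of_nat_eq_real_of_nat flip: ennreal_mult)
  have M1: "(\<integral>\<^sup>+ D. M D \<partial>P) = 1"
  proof -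
    have "(\<integral>\<^sup>+ D. M D \<partial>P) = (\<integral>\<^sup>+ D. (\<Sum>w\<in>W. ennreal (1/N) * R w D) \<partial>P)"
      unfolding M_def using N R0
      by (intro nn_integral_cong) (simp add: sum_divide_distrib flip: ennreal_mult)
    also have "\<dots> = (\<Sum>w\<in>W. ennreal (1/N) * (\<integral>\<^sup>+ D. R w D \<partial>P))"
      by (subst nn_integral_sum) (auto intro!: sum.cong nn_integral_cmult)
    finally show ?thesis using R1 avg by simp
  qed
  have M2: "(\<integral>\<^sup>+ D. ennreal ((M D)\<^sup>2) \<partial>P) \<le> 2"
  proof -
    have "(\<integral>\<^sup>+ D. ennreal ((M D)\<^sup>2) \<partial>P)
        = (\<integral>\<^sup>+ D. (\<Sum>w\<in>W. \<Sum>w'\<in>W. ennreal (1/N\<^sup>2) * (R w D * R w' D)) \<partial>P)"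
      unfolding M_def using N R0
      by (intro nn_integral_cong)
        (simp add: power2_eq_square sum_product sum_divide_distrib sum_nonneg flip: ennreal_mult)
    also have "\<dots> = (\<Sum>w\<in>W. \<Sum>w'\<in>W. ennreal (1/N\<^sup>2) * (\<integral>\<^sup>+ D. R w D * R w' D \<partial>P))"
      by (subst nn_integral_sum)
        (auto intro!: sum.cong simp: nn_integral_sum nn_integral_cmult)
    also have "\<dots> = ennreal (1/N\<^sup>2) * (\<Sum>w\<in>W. \<Sum>w'\<in>W. (\<integral>\<^sup>+ x. ennreal (r w x * r w' x) \<partial>p0) ^ n)"
      by (simp add: R2 sum_distrib_left)
    also have "\<dots> \<le> ennreal (1/N\<^sup>2) * ennreal (2 * N\<^sup>2)"
      using second by (intro mult_left_mono) (auto simp: N_def)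
    also have "\<dots> = 2" using N by (simp flip: ennreal_mult)
    finally show ?thesis .
  qed
  \<comment> \<open>The error against the mixture is the average over \<open>W\<close> of the errors
    against its components, so a uniform bound \<open>b\<close> passes to it.\<close>
  have err: "(\<integral>\<^sup>+ D. (1 - \<psi> D) * M D \<partial>P) \<le> b"
  proof -
    have "(\<integral>\<^sup>+ D. (1 - \<psi> D) * M D \<partial>P) = (\<integral>\<^sup>+ D. (\<Sum>w\<in>W. ennreal (1/N) * (R w D * ennreal (1 - \<psi> D))) \<partial>P)"
      unfolding M_def using N R0 \<psi>01
      by (intro nn_integral_cong)
        (simp add: sum_divide_distrib sum_distrib_left mult_ac flip: ennreal_mult)
    also have "\<dots> = (\<Sum>w\<in>W. ennreal (1/N) * (\<integral>\<^sup>+ D. R w D * ennreal (1 - \<psi> D) \<partial>P))"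
      by (subst nn_integral_sum) (auto intro!: sum.cong nn_integral_cmult)
    also have "\<dots> \<le> (\<Sum>w\<in>W. ennreal (1/N) * b)"
      using b dens by (intro sum_mono mult_left_mono) (auto simp: nn_integral_density)
    also have "\<dots> = b" by (subst sum_distrib_right[symmetric]) (simp only: avg mult_1)
    finally show ?thesis .
  qed
  have "ennreal 1 = (\<integral>\<^sup>+ D. M D \<partial>P)" by (simp add: M1)
  also have "\<dots> \<le> (\<integral>\<^sup>+ D. ennreal (\<psi> D) + (ennreal ((1 - \<psi> D) * M D) + ennreal (1/4) * ennreal ((M D)\<^sup>2)) \<partial>P)"
  proof (rule nn_integral_mono)
    fix D
    \<comment> \<open>This gets the inequality without passing through the minimum: the excess is a
      combination of two squares with weights \<psi> and 1 - \<psi>.\<close>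
    have "\<psi> D + ((1 - \<psi> D) * M D + 1/4 * (M D)\<^sup>2) - M D
        = \<psi> D * (M D / 2 - 1)\<^sup>2 + (1 - \<psi> D) * (M D)\<^sup>2 / 4"
      by (simp add: power2_eq_square field_simps)
    moreover have "\<dots> \<ge> 0" using \<psi>01[of D] by simp
    ultimately have "M D \<le> \<psi> D + ((1 - \<psi> D) * M D + 1/4 * (M D)\<^sup>2)" by linarith
    then show "ennreal (M D) \<le> ennreal (\<psi> D) + (ennreal ((1 - \<psi> D) * M D) + ennreal (1/4) * ennreal ((M D)\<^sup>2))"
      using \<psi>01[of D] M0[of D] by (simp flip: ennreal_mult ennreal_plus)
  qed
  also have "\<dots> = (\<integral>\<^sup>+ D. \<psi> D \<partial>P) + ((\<integral>\<^sup>+ D. (1 - \<psi> D) * M D \<partial>P) + ennreal (1/4) * (\<integral>\<^sup>+ D. ennreal ((M D)\<^sup>2) \<partial>P))"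
    by (simp add: nn_integral_add nn_integral_cmult)
  also have "\<dots> \<le> a + (b + ennreal (1/4) * 2)"
    using a err M2 unfolding P_def by (intro add_mono mult_left_mono) auto
  also have "ennreal (1/4) * 2 = ennreal (1/2)"
    using ennreal_mult[of "1/4" 2] by simp
  finally have "ennreal 1 \<le> (a + b) + ennreal (1/2)" by (simp add: add.assoc)
  \<comment> \<open>In the reals 1/2 can be subtracted from both sides; an infinite
    \<open>a + b\<close> meets the bound anyway.\<close>
  then show ?thesis
  proof (cases "a + b")
    case (real c)
    have "ennreal 1 \<le> ennreal (c + 1/2)"
      using \<open>ennreal 1 \<le> (a + b) + ennreal (1/2)\<close> unfolding real(2)
      by (subst ennreal_plus) (use real(1) in auto)
    then have "1 \<le> c + 1/2" using real(1) by (subst (asm) ennreal_le_iff) auto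
    then show ?thesis unfolding real(2) by (intro ennreal_leI) simp
  qed auto
qed

section \<open>Exponential moments of sums of random signs\<close>

lemma cosh_le_exp_square: "cosh (a::real) \<le> exp (a\<^sup>2 / 2)"
proof -
  have *: "cosh c \<le> exp (c\<^sup>2 / 2)" if "c \<ge> 0" for c :: real
  proof -
    \<comment> \<open>A fair sign scaled by c is a shifted fair Bernoulli variable with range of
      length 2c, so Hoeffding's bound h^2 / 8 at h = 2c gives c^2 / 2.\<close>
    have "1 + 1/2 * (exp (2 * c) - 1) = exp c * cosh c"
      by (simp add: cosh_def field_simps flip: exp_add)
    then have "ln (cosh c) = -(2 * c) * (1/2) + ln (1 + 1/2 * (exp (2 * c) - 1))"
      by (simp add: ln_mult)
    also have "\<dots> \<le> c\<^sup>2 / 2"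
      using Hoeffdings_lemma_aux[of "2 * c" "1/2"] that by (simp add: power_mult_distrib)
    finally show ?thesis by (metis cosh_real_pos exp_le_cancel_iff exp_ln)
  qed
  show ?thesis using *[of a] *[of "-a"] by (cases "a \<ge> 0") auto
qed

text \<open>For fixed w the products \<open>w k * w' k\<close> are again independent fair signs. The
  sum over w' then factors into terms \<open>2 * cosh (b k)\<close>, each subgaussian, and the
  resulting bound is the same for every w. The quadratic dependence on B is the gain from random
  signs.\<close>

lemma signs_average_le:
  fixes b :: "'k \<Rightarrow> real" and B :: real
  assumes K: "finite K" and b: "\<And>k. k \<in> K \<Longrightarrow> \<bar>b k\<bar> \<le> B"
  defines "W \<equiv> PiE K (\<lambda>_. {-1, 1::real})"
  shows "(\<Sum>w\<in>W. \<Sum>w'\<in>W. exp (\<Sum>k\<in>K. b k * w k * w' k)) \<le> exp (card K * B\<^sup>2 / 2) * (real (card W))\<^sup>2"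
proof -
  have cW: "card W = 2 ^ card K" unfolding W_def using K by (simp add: card_PiE numeral_2_eq_2)
  have "(\<Sum>w'\<in>W. exp (\<Sum>k\<in>K. b k * w k * w' k)) \<le> exp (card K * B\<^sup>2 / 2) * 2 ^ card K"
    if w: "w \<in> W" for w
  proof -
    have "(\<Sum>w'\<in>W. exp (\<Sum>k\<in>K. b k * w k * w' k)) = (\<Sum>w'\<in>W. \<Prod>k\<in>K. exp (b k * w k * w' k))"
      using K by (simp add: exp_sum)
    also have "\<dots> = (\<Prod>k\<in>K. \<Sum>s\<in>{-1, 1}. exp (b k * w k * s))"
      unfolding W_def using K by (subst prod_sum_PiE) auto
    also have "\<dots> \<le> (\<Prod>k\<in>K. 2 * exp (B\<^sup>2 / 2))"
    proof (rule prod_mono, safe)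
      fix k assume k: "k \<in> K"
      then have wk: "w k = -1 \<or> w k = 1" using w by (auto simp: W_def PiE_def Pi_def)
      show "0 \<le> (\<Sum>s\<in>{-1, 1}. exp (b k * w k * s))" by (intro sum_nonneg) auto
      \<comment> \<open>A negative \<open>w k\<close> merely swaps the two summands.\<close>
      have "(\<Sum>s\<in>{-1, 1}. exp (b k * w k * s)) = 2 * cosh (b k)"
        using wk by (auto simp: cosh_def)
      also have "\<dots> \<le> 2 * exp ((b k)\<^sup>2 / 2)" using cosh_le_exp_square[of "b k"] by simp
      also have "\<dots> \<le> 2 * exp (B\<^sup>2 / 2)"
        using power_mono[OF b[OF k], of 2] by simp
      finally show "(\<Sum>s\<in>{-1, 1}. exp (b k * w k * s)) \<le> 2 * exp (B\<^sup>2 / 2)" .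
    qed
    also have "\<dots> = exp (card K * B\<^sup>2 / 2) * 2 ^ card K"
      by (simp add: power_mult_distrib flip: exp_of_nat_mult)
    finally show ?thesis .
  qed
  then have "(\<Sum>w\<in>W. \<Sum>w'\<in>W. exp (\<Sum>k\<in>K. b k * w k * w' k))
      \<le> (\<Sum>w\<in>W. exp (card K * B\<^sup>2 / 2) * 2 ^ card K)"
    by (rule sum_mono)
  then show ?thesis by (simp add: cW power2_eq_square mult_ac)
qed


section \<open>Laws with a density in $Z$\<close>

text \<open>Counting times Lebesgue measure dominates every law in \<open>E01\<close>, which turns
  the distances between them into integrals of densities.\<close>

abbreviation base_measure :: "(nat \<times> nat \<times> real) measure" where
  "base_measure \<equiv> count_space UNIV \<Otimes>\<^sub>M (count_space UNIV \<Otimes>\<^sub>M lborel)"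

lemma sets_base_measure: "sets base_measure = sets obs_space"
  by (intro sets_pair_measure_cong refl) simp

lemma measurable_base_measure_eq: "base_measure \<rightarrow>\<^sub>M N = obs_space \<rightarrow>\<^sub>M N"
  by (rule measurable_cong_sets[OF sets_base_measure refl])

text \<open>The first two coordinates are countable and discrete, so measurability is a matter of
  the sections in z.\<close>

lemma measurable_obs_spaceI:
  assumes "\<And>x y. (\<lambda>z. f (x, y, z)) \<in> borel \<rightarrow>\<^sub>M N"
  shows "f \<in> obs_space \<rightarrow>\<^sub>M N"
  by (intro measurable_pair_measure_countable1 countableI_type) (use assms in auto)

text \<open>The order is chosen for conditioning on Z: z is outermost, and x and y are merged so
  that the inner integral can be taken against a mass function on pairs.\<close>

lemma nn_integral_base_measure:
  assumes f: "f \<in> borel_measurable obs_space"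
  shows "(\<integral>\<^sup>+ t. f t \<partial>base_measure)
    = (\<integral>\<^sup>+ z. \<integral>\<^sup>+ w. f (fst w, snd w, z) \<partial>count_space UNIV \<partial>lborel)"
proof -
  interpret N: sigma_finite_measure "count_space (UNIV::nat set)"
    by (rule sigma_finite_measure_count_space_countable) simp
  interpret P: pair_sigma_finite "count_space (UNIV::nat set)" lborel ..
  note [measurable] = f[folded measurable_base_measure_eq]
  have m: "(\<lambda>z. f (x, y, z)) \<in> borel_measurable lborel" for x y by measurable
  have "(\<integral>\<^sup>+ t. f (x, t) \<partial>(count_space UNIV \<Otimes>\<^sub>M lborel)) = (\<integral>\<^sup>+ y. \<integral>\<^sup>+ z. f (x, y, z) \<partial>lborel \<partial>count_space UNIV)" for x
    by (rule lborel.nn_integral_fst[symmetric]) measurable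
  then have "(\<integral>\<^sup>+ t. f t \<partial>base_measure)
      = (\<integral>\<^sup>+ x. \<integral>\<^sup>+ y. \<integral>\<^sup>+ z. f (x, y, z) \<partial>lborel \<partial>count_space UNIV \<partial>count_space UNIV)"
    by (subst P.nn_integral_fst[symmetric]) simp_all
  also have "\<dots> = (\<integral>\<^sup>+ w. \<integral>\<^sup>+ z. f (fst w, snd w, z) \<partial>lborel \<partial>count_space UNIV)"
    by (subst nn_integral_fst_count_space[symmetric]) simp
  also have "\<dots> = (\<integral>\<^sup>+ z. \<integral>\<^sup>+ w. f (fst w, snd w, z) \<partial>count_space UNIV \<partial>lborel)"
    by (rule nn_integral_count_space_nn_integral[symmetric]) (use m in auto)
  finally show ?thesis .
qed

lemma measurable_kernel_pmf:
  assumes "(\<lambda>z. measure_pmf (\<kappa> z)) \<in> borel \<rightarrow>\<^sub>M prob_algebra (count_space UNIV)"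
  shows "(\<lambda>z. pmf (\<kappa> z) w) \<in> borel_measurable borel"
  using measurable_compose[OF assms measurable_measure_prob_algebra, of "{w}"]
  by (simp add: measure_pmf_single)

text \<open>A measure on a countable set is the sum of its atoms. Writing that sum as an integral
  over counting measure gives measurability in z by Tonelli.\<close>

lemma measurable_kernelI:
  fixes \<kappa> :: "real \<Rightarrow> (nat \<times> nat) pmf"
  assumes "\<And>w. (\<lambda>z. pmf (\<kappa> z) w) \<in> borel_measurable borel"
  shows "(\<lambda>z. measure_pmf (\<kappa> z)) \<in> borel \<rightarrow>\<^sub>M prob_algebra (count_space UNIV)"
proof (intro measurable_prob_algebraI measurable_subprob_algebra)
  fix A :: "(nat \<times> nat) set"
  have "(\<lambda>z. emeasure (measure_pmf (\<kappa> z)) A) = (\<lambda>z. \<integral>\<^sup>+ w. ennreal (pmf (\<kappa> z) w) * indicator A w \<partial>count_space UNIV)"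
    by (simp add: nn_integral_pmf[symmetric] nn_integral_count_space_indicator)
  also have "\<dots> \<in> borel_measurable borel"
  proof (rule sigma_finite_measure.borel_measurable_nn_integral)
    show "sigma_finite_measure (count_space (UNIV :: (nat \<times> nat) set))"
      by (rule sigma_finite_measure_count_space_countable) simp
    have "(\<lambda>(w, z). ennreal (pmf (\<kappa> z) w) * indicator A w) \<in> borel_measurable (count_space UNIV \<Otimes>\<^sub>M borel)"
      by (intro measurable_pair_measure_countable1 countableI_type) (use assms in auto)
    from measurable_compose[OF measurable_pair_swap' this]
    show "(\<lambda>(z, w). ennreal (pmf (\<kappa> z) w) * indicator A w) \<in> borel_measurable (borel \<Otimes>\<^sub>M count_space UNIV)"
      by (simp add: case_prod_unfold)
  qed
  finally show "(\<lambda>z. emeasure (measure_pmf (\<kappa> z)) A) \<in> borel_measurable borel" .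
qed (auto simp: prob_space_measure_pmf prob_space_imp_subprob_space)

text \<open>Normal form of the laws in \<open>E01\<close>: by \<open>E01_joint_law\<close> each of
  them arises in this way from a density of Z and any version of its conditional law.\<close>

definition joint_law :: "(real \<Rightarrow> real) \<Rightarrow> (real \<Rightarrow> (nat \<times> nat) pmf) \<Rightarrow> (nat \<times> nat \<times> real) measure" where
  "joint_law h \<kappa> = density base_measure (\<lambda>(x, y, z). h z * pmf (\<kappa> z) (x, y))"

locale kernel =
  fixes h :: "real \<Rightarrow> real" and \<kappa> :: "real \<Rightarrow> (nat \<times> nat) pmf"
  assumes h_measurable [measurable]: "h \<in> borel_measurable borel"
    and h_nonneg: "\<And>z. 0 \<le> h z"
    and h_integral: "(\<integral>\<^sup>+ z. h z \<partial>lborel) = 1"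
    and \<kappa>_measurable: "(\<lambda>z. measure_pmf (\<kappa> z)) \<in> borel \<rightarrow>\<^sub>M prob_algebra (count_space UNIV)"
begin

lemma density_measurable:
  "(\<lambda>(x, y, z). h z * pmf (\<kappa> z) (x, y)) \<in> borel_measurable obs_space"
  using measurable_kernel_pmf[OF \<kappa>_measurable] by (intro measurable_obs_spaceI) simp

text \<open>These are the sets on which \<open>cond_version\<close> is stated. The law of Z, the
  total mass and the role of \<open>\<kappa>\<close> as conditional law are all read off from this
  formula.\<close>

lemma emeasure_joint_law:
  assumes B: "B \<in> sets borel"
  shows "emeasure (joint_law h \<kappa>) {(x, y, z). (x, y) \<in> A \<and> z \<in> B}
    = (\<integral>\<^sup>+ z. ennreal (h z) * (emeasure (measure_pmf (\<kappa> z)) A * indicator B z) \<partial>lborel)"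
proof -
  let ?S = "{(x, y, z). (x, y) \<in> A \<and> z \<in> B}"
  have "Measurable.pred obs_space (\<lambda>t. t \<in> ?S)"
    by (rule measurable_obs_spaceI) (use B in simp)
  then have S: "?S \<in> sets obs_space"
    by (simp add: pred_def space_pair_measure)
  have m: "(\<lambda>t. ennreal (case t of (x, y, z) \<Rightarrow> h z * pmf (\<kappa> z) (x, y))) \<in> borel_measurable obs_space"
    using density_measurable by simp
  have "emeasure (joint_law h \<kappa>) ?S
      = (\<integral>\<^sup>+ t. ennreal (case t of (x, y, z) \<Rightarrow> h z * pmf (\<kappa> z) (x, y)) * indicator ?S t \<partial>base_measure)"
    unfolding joint_law_def
    by (rule emeasure_density) (use m S in \<open>simp_all add: measurable_base_measure_eq sets_base_measure\<close>)
  also have "\<dots> = (\<integral>\<^sup>+ z. \<integral>\<^sup>+ w. ennreal (h z * pmf (\<kappa> z) w) * indicator ?S (fst w, snd w, z) \<partial>count_space UNIV \<partial>lborel)"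
    by (subst nn_integral_base_measure) (use m S in \<open>auto intro!: borel_measurable_times_ennreal\<close>)
  also have "\<dots> = (\<integral>\<^sup>+ z. \<integral>\<^sup>+ w. (ennreal (h z) * indicator B z) * (ennreal (pmf (\<kappa> z) w) * indicator A w) \<partial>count_space UNIV \<partial>lborel)"
    by (intro nn_integral_cong) (auto simp: ennreal_mult h_nonneg split: split_indicator)
  also have "\<dots> = (\<integral>\<^sup>+ z. (ennreal (h z) * indicator B z) * emeasure (measure_pmf (\<kappa> z)) A \<partial>lborel)"
    by (simp add: nn_integral_cmult nn_integral_pmf[symmetric] nn_integral_count_space_indicator)
  finally show ?thesis by (simp add: mult_ac)
qed

lemma sets_joint_law: "sets (joint_law h \<kappa>) = sets obs_space"
  unfolding joint_law_def by (simp add: sets_base_measure)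

lemma Z_law_joint_law: "Z_law (joint_law h \<kappa>) = density lborel h"
proof (rule measure_eqI)
  show "sets (Z_law (joint_law h \<kappa>)) = sets (density lborel h)" by (simp add: Z_law_def)
  fix B assume "B \<in> sets (Z_law (joint_law h \<kappa>))"
  then have B: "B \<in> sets borel" by (simp add: Z_law_def)
  have "(\<lambda>(x, y, z). z) \<in> joint_law h \<kappa> \<rightarrow>\<^sub>M borel"
    by (subst measurable_cong_sets[OF sets_joint_law refl]) measurable
  then have "emeasure (Z_law (joint_law h \<kappa>)) B = emeasure (joint_law h \<kappa>) {(x, y, z). (x, y) \<in> UNIV \<and> z \<in> B}"
    unfolding Z_law_def using B
    by (subst emeasure_distr)
      (auto simp: sets_eq_imp_space_eq[OF sets_joint_law] space_pair_measure intro!: arg_cong[where f="emeasure _"])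
  also have "\<dots> = emeasure (density lborel h) B"
    using B unfolding emeasure_joint_law[OF B] by (simp add: emeasure_density)
  finally show "emeasure (Z_law (joint_law h \<kappa>)) B = emeasure (density lborel h) B" .
qed

lemma prob_space_joint_law: "prob_space (joint_law h \<kappa>)"
proof
  have "space (joint_law h \<kappa>) = {(x, y, z). (x, y) \<in> UNIV \<and> z \<in> UNIV}"
    by (auto simp: sets_eq_imp_space_eq[OF sets_joint_law] space_pair_measure)
  then show "emeasure (joint_law h \<kappa>) (space (joint_law h \<kappa>)) = 1"
    using emeasure_joint_law[of UNIV UNIV] h_integral by simp
qed

lemma cond_version_joint_law: "cond_version (joint_law h \<kappa>) \<kappa>"
proof -
  have [measurable]: "(\<lambda>z. emeasure (measure_pmf (\<kappa> z)) A) \<in> borel_measurable borel" for A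
    using measurable_compose[OF measurable_prob_algebraD[OF \<kappa>_measurable] measurable_emeasure_subprob_algebra]
    by simp
  show ?thesis unfolding cond_version_def
    using \<kappa>_measurable
    by (auto simp: emeasure_joint_law Z_law_joint_law nn_integral_density mult.assoc)
qed

lemma joint_law_in_E01:
  assumes "\<And>z. z \<notin> {0..1} \<Longrightarrow> h z = 0" and "\<And>z. set_pmf (\<kappa> z) \<subseteq> {1..l1} \<times> {1..l2}"
  shows "joint_law h \<kappa> \<in> E01 l1 l2"
  unfolding E01_def
proof (intro CollectI conjI exI)
  show "AE z in Z_law (joint_law h \<kappa>). z \<in> {0..1}"
    unfolding Z_law_joint_law by (subst AE_density) (use assms(1) in \<open>force intro!: AE_I2\<close>)+
  show "absolutely_continuous lborel (Z_law (joint_law h \<kappa>))"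
    unfolding Z_law_joint_law by (intro absolutely_continuousI_density) simp
qed (use assms(2) in \<open>auto intro!: prob_space_joint_law sets_joint_law cond_version_joint_law\<close>)

end

text \<open>Pairs (x, y) are countable, so every measurable set is a countable disjoint union of
  pieces {w} times a Borel set of z, and on such a piece the law of Z and the kernel determine the
  mass.\<close>

lemma eq_of_cond_version:
  assumes q: "sets q = sets obs_space" and q': "sets q' = sets obs_space"
    and Z: "Z_law q = Z_law q'" and c: "cond_version q \<kappa>" "cond_version q' \<kappa>"
  shows "q = q'"
proof (rule measure_eqI)
  show "sets q = sets q'" using q q' by simp
  fix S assume "S \<in> sets q"
  then have S: "S \<in> sets obs_space" using q by simp
  define B where "B w = {z. (fst w, snd w, z) \<in> S}" for w
  have B [measurable]: "B w \<in> sets borel" for w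
    using sets_Pair1[OF sets_Pair1[OF S, of "fst w"], of "snd w"] by (simp add: vimage_def B_def)
  define X where "X w = {(x, y, z). (x, y) \<in> {w} \<and> z \<in> B w}" for w
  have "Measurable.pred obs_space (\<lambda>t. t \<in> X w)" for w
    unfolding X_def mem_Collect_eq case_prod_conv by (rule measurable_obs_spaceI) simp
  then have X: "X w \<in> sets obs_space" for w by (simp add: pred_def space_pair_measure)
  have SX: "S = (\<Union>w. X w)" by (auto simp: X_def B_def)
  have disj: "disjoint_family X" by (auto simp: X_def disjoint_family_on_def)
  have EX: "emeasure p (X w) = (\<integral>\<^sup>+ z\<in>B w. emeasure (measure_pmf (\<kappa> z)) {w} \<partial>Z_law p)"
    if "cond_version p \<kappa>" for p w
    unfolding X_def
    by (rule that[unfolded cond_version_def, THEN conjunct2, THEN spec, THEN bspec, OF B])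
  have e: "emeasure q (X w) = emeasure q' (X w)" for w
    by (simp only: EX[OF c(1)] EX[OF c(2)] Z)
  show "emeasure q S = emeasure q' S" unfolding SX
    by (subst (1 2) emeasure_UN_countable) (use X q q' disj e in auto)
qed

text \<open>Radon-Nikodym supplies the density of Z, and \<open>eq_of_cond_version\<close> does the
  rest. The version \<open>\<kappa>\<close> is prescribed by the caller, so that it can be the one
  under which X and Y are independent.\<close>

lemma E01_joint_law:
  assumes q: "q \<in> E01 l1 l2" and c: "cond_version q \<kappa>"
  obtains h where "kernel h \<kappa>" "q = joint_law h \<kappa>" "Z_law q = density lborel h"
proof -
  interpret q: prob_space q using q by (simp add: E01_def)
  have sq: "sets q = sets obs_space" and ac: "absolutely_continuous lborel (Z_law q)" using q by (auto simp: E01_def)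
  have "(\<lambda>(x, y, z). z) \<in> q \<rightarrow>\<^sub>M borel"
    by (subst measurable_cong_sets[OF sq refl]) measurable
  then interpret Z: prob_space "Z_law q" unfolding Z_law_def by (rule q.prob_space_distr)
  have sZ: "sets (Z_law q) = sets lborel" by (simp add: Z_law_def)
  obtain h where h: "h \<in> borel_measurable lborel" "AE z in lborel. RN_deriv lborel (Z_law q) z = ennreal (h z)" "\<And>z. 0 \<le> h z"
    using sigma_finite_measure.real_RN_deriv[OF sigma_finite_lborel Z.finite_measure_axioms ac sZ] by metis
  have "Z_law q = density lborel (RN_deriv lborel (Z_law q))"
    using sigma_finite_measure.density_RN_deriv[OF sigma_finite_lborel ac sZ] by simp
  also have "\<dots> = density lborel h"
    by (rule density_cong) (use h in auto)
  finally have Zh: "Z_law q = density lborel h" .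
  have "(\<integral>\<^sup>+ z. h z \<partial>lborel) = emeasure (density lborel h) (space lborel)"
    using h by (simp add: emeasure_density)
  also have "\<dots> = 1" using Z.emeasure_space_1 by (simp add: Zh)
  finally have k: "kernel h \<kappa>"
    by unfold_locales (use h c in \<open>auto simp: cond_version_def\<close>)
  interpret kernel h \<kappa> by fact
  have "q = joint_law h \<kappa>"
    by (rule eq_of_cond_version[OF sq sets_joint_law _ c cond_version_joint_law])
      (simp add: Zh Z_law_joint_law)
  then show thesis using that k Zh by blast
qed


section \<open>Distances\<close>

lemma l1_dist_self: "l1_dist p p = 0"
  by (simp add: l1_dist_def Let_def)

lemma chi2_div_self:
  fixes p :: "'a pmf"
  shows "chi2_div p p = 0"
proof -
  have "AE x in measure_pmf p. 1 = RN_deriv (measure_pmf p) (measure_pmf p) x" (is "AE x in _. 1 = ?r x")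
    by (rule sigma_finite_measure.RN_deriv_unique[OF measure_pmf.sigma_finite_measure_axioms])
      (simp_all add: density_1)
  then have "AE x in measure_pmf p. ennreal ((enn2real (?r x) - 1)\<^sup>2) = 0"
    by (rule eventually_mono) (drule sym, simp)
  then have *: "(\<integral>\<^sup>+ x. ennreal ((enn2real (?r x) - 1)\<^sup>2) \<partial>measure_pmf p) = (\<integral>\<^sup>+ x. 0 \<partial>measure_pmf p)"
    by (rule nn_integral_cong_AE)
  have ac: "absolutely_continuous (measure_pmf p) (measure_pmf p)"
    unfolding absolutely_continuous_def by (rule subset_refl)
  show ?thesis
    unfolding chi2_div_def if_P[OF ac] * by simp
qed

lemma indep_var_pair_pmf:
  fixes A B :: "'a::countable pmf"
  shows "prob_space.indep_var (measure_pmf (pair_pmf A B)) (count_space UNIV) fst (count_space UNIV) snd"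
proof -
  have 1: "distr (measure_pmf (pair_pmf A B)) (count_space UNIV) fst = measure_pmf A"
    by (metis map_fst_pair_pmf map_pmf_rep_eq)
  have 2: "distr (measure_pmf (pair_pmf A B)) (count_space UNIV) snd = measure_pmf B"
    by (metis map_snd_pair_pmf map_pmf_rep_eq)
  \<comment> \<open>On countable types the product of discrete sigma-algebras is discrete, so all
    rectangles are measurable.\<close>
  have s: "sets (count_space (UNIV::'a set) \<Otimes>\<^sub>M count_space (UNIV::'a set)) = UNIV"
    by (subst pair_measure_countable) auto
  have "measure_pmf A \<Otimes>\<^sub>M measure_pmf B
      = distr (measure_pmf (pair_pmf A B)) (count_space UNIV \<Otimes>\<^sub>M count_space UNIV) (\<lambda>x. (fst x, snd x))"
  proof (rule pair_measure_eqI)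
    show "sets (measure_pmf A \<Otimes>\<^sub>M measure_pmf B)
        = sets (distr (measure_pmf (pair_pmf A B)) (count_space UNIV \<Otimes>\<^sub>M count_space UNIV) (\<lambda>x. (fst x, snd x)))"
      unfolding sets_distr by (rule sets_pair_measure_cong) simp_all
    fix X Y
    have "emeasure (distr (measure_pmf (pair_pmf A B)) (count_space UNIV \<Otimes>\<^sub>M count_space UNIV) (\<lambda>x. (fst x, snd x))) (X \<times> Y)
        = emeasure (measure_pmf (pair_pmf A B)) (X \<times> Y)"
      by (subst emeasure_distr) (auto simp: s space_pair_measure pair_measure_countable vimage_def)
    then show "emeasure (measure_pmf A) X * emeasure (measure_pmf B) Y
        = emeasure (distr (measure_pmf (pair_pmf A B)) (count_space UNIV \<Otimes>\<^sub>M count_space UNIV) (\<lambda>x. (fst x, snd x))) (X \<times> Y)"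
      by (simp add: measure_pmf.emeasure_eq_measure measure_pmf_prob_product ennreal_mult)
  qed (auto intro: measure_pmf.sigma_finite_measure_axioms)
  then show ?thesis
    by (subst prob_space.indep_var_distribution_eq[OF prob_space_measure_pmf]) (simp add: 1 2)
qed

lemma pmf_indep_var:
  assumes "prob_space.indep_var (measure_pmf p) (count_space UNIV) fst (count_space UNIV) snd"
  shows "pmf p (x, y) = pmf (map_pmf fst p) x * pmf (map_pmf snd p) y"
proof -
  have "measure_pmf.prob p ((\<lambda>w. (fst w, snd w)) -` ({x} \<times> {y}) \<inter> space (measure_pmf p))
      = measure_pmf.prob p (fst -` {x} \<inter> space (measure_pmf p)) * measure_pmf.prob p (snd -` {y} \<inter> space (measure_pmf p))"
    by (rule prob_space.indep_varD[OF prob_space_measure_pmf assms]) auto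
  then show ?thesis
    by (simp add: pmf_map vimage_def prod_eq_iff flip: measure_pmf_single)
qed

lemma l1_dist_pmf_finite:
  fixes p q :: "'a pmf"
  assumes F: "finite F" "set_pmf p \<subseteq> F" "set_pmf q \<subseteq> F"
  shows "l1_dist p q = ennreal (\<Sum>x\<in>F. \<bar>pmf p x - pmf q x\<bar>)"
proof -
  have "l1_dist p q = (\<integral>\<^sup>+ x. ennreal \<bar>pmf p x - pmf q x\<bar> \<partial>count_space UNIV)"
    by (rule l1_dist_density)
      (auto simp: measure_pmf_eq_density[symmetric] prob_space_measure_pmf)
  also have "\<dots> = (\<Sum>x\<in>F. ennreal \<bar>pmf p x - pmf q x\<bar>)"
  proof (rule nn_integral_count_space'[OF F(1)])
    fix x assume "x \<notin> F"
    then have "pmf p x = 0" "pmf q x = 0" using F by (auto simp: pmf_eq_0_set_pmf)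
    then show "ennreal \<bar>pmf p x - pmf q x\<bar> = 0" by simp
  qed simp
  finally show ?thesis by simp
qed

lemma l1_dist_joint_law:
  assumes "kernel h \<kappa>" "kernel h' \<kappa>'"
  shows "l1_dist (joint_law h \<kappa>) (joint_law h' \<kappa>')
    = (\<integral>\<^sup>+ z. \<integral>\<^sup>+ w. ennreal \<bar>h z * pmf (\<kappa> z) w - h' z * pmf (\<kappa>' z) w\<bar> \<partial>count_space UNIV \<partial>lborel)"
proof -
  interpret k: kernel h \<kappa> by fact
  interpret k': kernel h' \<kappa>' by fact
  note m = k.density_measurable k'.density_measurable
  have "l1_dist (joint_law h \<kappa>) (joint_law h' \<kappa>') = (\<integral>\<^sup>+ t. ennreal \<bar>(case t of (x, y, z) \<Rightarrow> h z * pmf (\<kappa> z) (x, y))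
      - (case t of (x, y, z) \<Rightarrow> h' z * pmf (\<kappa>' z) (x, y))\<bar> \<partial>base_measure)"
    by (rule l1_dist_density[OF _ _ _ _ joint_law_def k.prob_space_joint_law joint_law_def k'.prob_space_joint_law])
      (use m in \<open>auto simp: measurable_base_measure_eq k.h_nonneg k'.h_nonneg\<close>)
  also have "\<dots> = (\<integral>\<^sup>+ z. \<integral>\<^sup>+ w. ennreal \<bar>h z * pmf (\<kappa> z) w - h' z * pmf (\<kappa>' z) w\<bar> \<partial>count_space UNIV \<partial>lborel)"
  proof (subst nn_integral_base_measure)
    show "(\<lambda>t. ennreal \<bar>(case t of (x, y, z) \<Rightarrow> h z * pmf (\<kappa> z) (x, y))
        - (case t of (x, y, z) \<Rightarrow> h' z * pmf (\<kappa>' z) (x, y))\<bar>) \<in> borel_measurable obs_space"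
      by (intro measurable_compose[OF _ measurable_ennreal] borel_measurable_abs borel_measurable_diff m)
  qed simp
  finally show ?thesis .
qed

text \<open>
  Conditional independence makes every $2 \times 2$ block of the conditional density singular, whatever
  the density of $Z$; this bounds the $L_1$ distance to all of \<^const>\<open>P01\<close> pointwise in $z$.
\<close>

lemma rank_one_distance:
  fixes u c :: real
  assumes c: "0 \<le> c" and q: "0 \<le> q11" "0 \<le> q12" "0 \<le> q21" "0 \<le> q22" "q11 * q22 = q12 * q21"
  shows "\<bar>u\<bar> \<le> \<bar>c + u - q11\<bar> + \<bar>c - u - q12\<bar> + \<bar>c - u - q21\<bar> + \<bar>c + u - q22\<bar>"
\<comment> \<open>If all four errors together were below \<bar>u\<bar>, no entry could cross c: the
  two entries of one diagonal would lie strictly above c and the two of the other strictly below.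
  The diagonal products would then lie on opposite sides of c^2, against singularity.\<close>
proof (rule ccontr)
  assume *: "\<not> ?thesis"
  have lt: "c * c > a * b" if "0 \<le> a" "0 \<le> b" "a < c" "b < c" for a b
    using that by (meson mult_strict_mono' )
  have gt: "c * c < a * b" if "c < a" "c < b" for a b
    using that c by (intro mult_strict_mono') auto
  show False
  proof (cases "u \<ge> 0")
    case True
    then have "q12 < c" "q21 < c" "c < q11" "c < q22" using * by (auto split: if_splits simp: abs_if)
    then show False using lt[of q12 q21] gt[of q11 q22] q by auto
  next
    case False
    then have "c < q12" "c < q21" "q11 < c" "q22 < c" using * by (auto split: if_splits simp: abs_if)
    then show False using lt[of q11 q22] gt[of q12 q21] q by auto
  qed
qed

lemma sum_pairs:
  fixes g :: "nat \<Rightarrow> 'a::comm_monoid_add"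
  shows "(\<Sum>x\<in>{1..2 * m}. g x) = (\<Sum>a<m. g (2 * a + 1) + g (2 * a + 2))"
  by (induction m) (simp_all add: add.assoc)


section \<open>Tent functions\<close>

text \<open>For d \<ge> 1 this is the distance from z to the complement of the j-th bin, whose
  centre is (2j + 1) / (2d): the largest function of slope at most 1 that vanishes off the
  bin.\<close>

definition tent :: "nat \<Rightarrow> nat \<Rightarrow> real \<Rightarrow> real" where
  "tent d j z = max 0 (1 / (2 * real d) - \<bar>z - (2 * real j + 1) / (2 * real d)\<bar>)"

lemma tent_nonneg: "0 \<le> tent d j z"
  and tent_le: "tent d j z \<le> 1 / (2 * real d)"
  and tent_lipschitz: "\<bar>tent d j z - tent d j z'\<bar> \<le> \<bar>z - z'\<bar>"
  by (auto simp: tent_def)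

lemma tent_measurable [measurable]: "tent d j \<in> borel_measurable borel"
  unfolding tent_def by measurable

text \<open>Each tent value is the distance to the edge of its own bin, and a path between different
  bins covers both distances. In terms of centres: they are at least 1/d apart, which is the sum of
  the two half-widths.\<close>

lemma tent_disjoint:
  assumes "i \<noteq> j" "0 < tent d i z" "0 < tent d j z'"
  shows "tent d i z + tent d j z' \<le> \<bar>z - z'\<bar>"
proof -
  define c where "c k = (2 * real k + 1) / (2 * real d)" for k
  \<comment> \<open>For d = 0 the division yields 0 and the tent vanishes identically, so positivity
    excludes this case.\<close>
  have d: "d > 0" using assms(2) by (auto simp: tent_def intro: ccontr)
  have "1 \<le> \<bar>real i - real j\<bar>" using assms(1) by linarith
  moreover have "c i - c j = (real i - real j) / real d"
    using d by (simp add: c_def field_simps)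
  ultimately have "1 / real d \<le> \<bar>c i - c j\<bar>"
    using d by (simp add: divide_right_mono)
  moreover have "tent d i z = 1 / (2 * real d) - \<bar>z - c i\<bar>" "tent d j z' = 1 / (2 * real d) - \<bar>z' - c j\<bar>"
    using assms(2,3) by (auto simp: tent_def c_def max_def split: if_splits)
  moreover have "1 / (2 * real d) + 1 / (2 * real d) = 1 / real d" by simp
  ultimately show ?thesis by linarith
qed

text \<open>At a given z at most one tent is positive. The index is uniform in c, so that several
  coefficient vectors can be evaluated at the same z; if no tent is positive, index 0 is
  taken.\<close>

lemma tent_sum_single:
  assumes "d \<ge> 1"
  obtains i where "i < d" "\<And>c. (\<Sum>j<d. c j * tent d j z) = c i * tent d i z"
proof (cases "\<exists>i<d. 0 < tent d i z")
  case True
  then obtain i where i: "i < d" "0 < tent d i z" by blast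
  have "tent d j z = 0" if "j \<noteq> i" for j
    using tent_disjoint[OF that _ i(2), of z] i(2) tent_nonneg[of d j z] by force
  then have "(\<Sum>j<d. c j * tent d j z) = (\<Sum>j\<in>{i}. c j * tent d j z)" for c :: "nat \<Rightarrow> real"
    using i by (intro sum.mono_neutral_right) auto
  then show ?thesis using that i by simp
next
  case False
  then have "tent d j z = 0" if "j < d" for j
    using that tent_nonneg[of d j z] by force
  then show ?thesis using that[of 0] assms by simp
qed

text \<open>The coefficient can change only between bins, and there the sum is zero. Within one bin
  the slope of the tent decides, across two bins \<open>tent_disjoint\<close> does.\<close>

lemma tent_sum_lipschitz:
  assumes d: "d \<ge> 1" and c: "\<And>j. j < d \<Longrightarrow> \<bar>c j\<bar> = 1"
  shows "\<bar>(\<Sum>j<d. c j * tent d j z) - (\<Sum>j<d. c j * tent d j z')\<bar> \<le> \<bar>z - z'\<bar>"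
proof -
  obtain i where i: "i < d" "\<And>c. (\<Sum>j<d. c j * tent d j z) = c i * tent d i z"
    using tent_sum_single[OF d] by blast
  obtain i' where i': "i' < d" "\<And>c. (\<Sum>j<d. c j * tent d j z') = c i' * tent d i' z'"
    using tent_sum_single[OF d] by blast
  \<comment> \<open>With these coefficients the sum isolates one tent. It shows that a tent other
    than the selected one vanishes at the point.\<close>
  have single: "(\<Sum>j<d. of_bool (j = k) * tent d j y) = tent d k y" if "k < d" for k y
    using that by simp
  have scale: "\<bar>c k * s - c k * t\<bar> = \<bar>s - t\<bar>" if "k < d" for k s t
    using c[OF that] by (simp add: abs_mult flip: right_diff_distrib)
  consider "i = i'" | "i \<noteq> i'" "tent d i z = 0" | "i \<noteq> i'" "tent d i' z' = 0"
    | "i \<noteq> i'" "0 < tent d i z" "0 < tent d i' z'"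
    using tent_nonneg[of d i z] tent_nonneg[of d i' z'] by fastforce
  then show ?thesis
  proof cases
    case 1
    then show ?thesis unfolding i(2) i'(2) using scale i tent_lipschitz by simp
  next
    case 2
    then have "tent d i' z = 0" using i(2)[of "\<lambda>j. of_bool (j = i')"] single[OF i'(1)] by simp
    then show ?thesis unfolding i(2) i'(2) using 2 scale[OF i'(1), of 0 "tent d i' z'"] tent_lipschitz[of d i' z z'] by simp
  next
    case 3
    then have "tent d i z' = 0" using i'(2)[of "\<lambda>j. of_bool (j = i)"] single[OF i(1)] by simp
    then show ?thesis unfolding i(2) i'(2) using 3 scale[OF i(1), of "tent d i z" 0] tent_lipschitz[of d i z z'] by simp
  next
    case 4
    have "\<bar>c i * tent d i z - c i' * tent d i' z'\<bar> \<le> tent d i z + tent d i' z'"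
      using c[OF i(1)] c[OF i'(1)] 4 abs_triangle_ineq4[of "c i * tent d i z" "c i' * tent d i' z'"]
      by (simp add: abs_mult)
    then show ?thesis unfolding i(2) i'(2) using tent_disjoint[OF 4] by linarith
  qed
qed

lemma tent_sum_abs:
  assumes d: "d \<ge> 1" and c: "\<And>j. j < d \<Longrightarrow> \<bar>c j\<bar> = 1"
  shows "\<bar>\<Sum>j<d. c j * tent d j z\<bar> = (\<Sum>j<d. tent d j z)"
proof -
  obtain i where i: "i < d" "\<And>c. (\<Sum>j<d. c j * tent d j z) = c i * tent d i z"
    using tent_sum_single[OF d] by blast
  show ?thesis using i(2)[of c] i(2)[of "\<lambda>_. 1"] c[OF i(1)] tent_nonneg[of d i z] by (simp add: abs_mult)
qed

lemma tent_sum_le: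
  assumes d: "d \<ge> 1"
  shows "(\<Sum>j<d. tent d j z) \<le> 1/2"
proof -
  obtain i where i: "i < d" "\<And>c. (\<Sum>j<d. c j * tent d j z) = c i * tent d i z"
    using tent_sum_single[OF d] by blast
  have "1 / (2 * real d) \<le> 1/2" using d by (simp add: field_simps)
  then show ?thesis using i(2)[of "\<lambda>_. 1"] tent_le[of d i z] by simp
qed

text \<open>Products of different tents vanish. This makes the correlation of two alternatives
  diagonal in the bins.\<close>

lemma tent_sum_mult:
  assumes d: "d \<ge> 1"
  shows "(\<Sum>j<d. c j * tent d j z) * (\<Sum>j<d. c' j * tent d j z) = (\<Sum>j<d. c j * c' j * (tent d j z)\<^sup>2)"
proof -
  obtain i where i: "i < d" "\<And>c. (\<Sum>j<d. c j * tent d j z) = c i * tent d i z"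
    using tent_sum_single[OF d] by blast
  show ?thesis using i(2)[of "\<lambda>j. c j * c' j * tent d j z"] by (simp add: i(2) power2_eq_square mult_ac)
qed

text \<open>Height squared times width: (1 / (2d))^2 * (1/d).\<close>

lemma tent_square_integral:
  assumes d: "d \<ge> 1"
  shows "integrable lborel (\<lambda>z. indicator {0..1} z * (tent d j z)\<^sup>2)"
    and "\<bar>\<integral>z. indicator {0..1} z * (tent d j z)\<^sup>2 \<partial>lborel\<bar> \<le> 1 / (4 * real d ^ 3)"
proof -
  define r where "r = 1 / (2 * real d)"
  define c where "c = (2 * real j + 1) / (2 * real d)"
  have r: "r \<ge> 0" by (simp add: r_def)
  let ?g = "\<lambda>z. r\<^sup>2 * indicator {c - r..c + r} z :: real"
  have g: "integrable lborel ?g" by (intro integrable_mult_right integrable_real_indicator) (auto simp: emeasure_lborel_Icc_eq)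
  have bound: "\<bar>indicator {0..1} z * (tent d j z)\<^sup>2\<bar> \<le> ?g z" for z
  proof (cases "z \<in> {c - r..c + r}")
    case True
    then show ?thesis using power_mono[OF tent_le tent_nonneg, of d j z 2]
      by (auto simp: r_def split: split_indicator)
  next
    case False
    then have "tent d j z = 0" unfolding tent_def r_def[symmetric] c_def[symmetric] by auto
    then show ?thesis by simp
  qed
  show f: "integrable lborel (\<lambda>z. indicator {0..1} z * (tent d j z)\<^sup>2)"
    by (rule Bochner_Integration.integrable_bound[OF g]) (use bound in \<open>auto intro!: AE_I2 order_trans[OF _ abs_ge_self]\<close>)
  have "\<bar>\<integral>z. indicator {0..1} z * (tent d j z)\<^sup>2 \<partial>lborel\<bar> \<le> (\<integral>z. \<bar>indicator {0..1} z * (tent d j z)\<^sup>2\<bar> \<partial>lborel)"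
    by (rule integral_abs_bound)
  also have "\<dots> \<le> (\<integral>z. ?g z \<partial>lborel)"
    by (rule integral_mono[OF integrable_abs[OF f] g bound])
  also have "\<dots> = 1 / (4 * real d ^ 3)"
    using r d by (simp add: r_def field_simps power2_eq_square power3_eq_cube)
  finally show "\<bar>\<integral>z. indicator {0..1} z * (tent d j z)\<^sup>2 \<partial>lborel\<bar> \<le> 1 / (4 * real d ^ 3)" .
qed

text \<open>On the middle half of a bin, of length r = 1 / (2d), the tent is at least r / 2. The d
  bins together give d * r^2 / 2 = 1 / (8d).\<close>

lemma tent_sum_integral_ge:
  assumes d: "d \<ge> 1"
  shows "ennreal (1 / (8 * real d)) \<le> (\<integral>\<^sup>+ z. ennreal (indicator {0..1} z * (\<Sum>j<d. tent d j z)) \<partial>lborel)"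
proof -
  define r where "r = 1 / (2 * real d)"
  define c where "c j = (2 * real j + 1) / (2 * real d)" for j
  have r: "r > 0" using d by (simp add: r_def)
  have bound: "r / 2 * indicator {c j - r / 2..c j + r / 2} z \<le> indicator {0..1} z * tent d j z" if j: "j < d" for j z
  proof (cases "z \<in> {c j - r / 2..c j + r / 2}")
    case True
    have "r \<le> c j" "c j + r \<le> 1"
      using d j by (auto simp: c_def r_def field_simps)
    moreover have "\<bar>z - c j\<bar> \<le> r / 2" using True unfolding atLeastAtMost_iff by linarith
    then have "r / 2 \<le> tent d j z"
      unfolding tent_def r_def[symmetric] c_def[symmetric] by (simp add: max_def)
    ultimately show ?thesis using True r by auto
  next
    case False
    then show ?thesis using tent_nonneg[of d j z] by (auto split: split_indicator)
  qed
  have "ennreal (1 / (8 * real d)) = (\<Sum>j<d. ennreal (r / 2) * ennreal r)"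
    using r d by (simp add: ennreal_of_nat_eq_real_of_nat r_def field_simps flip: ennreal_mult)
  also have "\<dots> = (\<Sum>j<d. \<integral>\<^sup>+ z. ennreal (r / 2) * indicator {c j - r / 2..c j + r / 2} z \<partial>lborel)"
    using r by (simp add: nn_integral_cmult)
  also have "\<dots> = (\<integral>\<^sup>+ z. (\<Sum>j<d. ennreal (r / 2) * indicator {c j - r / 2..c j + r / 2} z) \<partial>lborel)"
    by (rule nn_integral_sum[symmetric]) simp
  also have "\<dots> \<le> (\<integral>\<^sup>+ z. ennreal (indicator {0..1} z * (\<Sum>j<d. tent d j z)) \<partial>lborel)"
  proof (rule nn_integral_mono)
    fix z
    have "(\<Sum>j<d. ennreal (r / 2) * indicator {c j - r / 2..c j + r / 2} z)
        = (\<Sum>j<d. ennreal (r / 2 * indicator {c j - r / 2..c j + r / 2} z))"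
      using r by (intro sum.cong refl) (simp split: split_indicator)
    also have "\<dots> = ennreal (\<Sum>j<d. r / 2 * indicator {c j - r / 2..c j + r / 2} z)"
      using r by (intro sum_ennreal) simp
    also have "\<dots> \<le> ennreal (\<Sum>j<d. indicator {0..1} z * tent d j z)"
      using bound by (intro ennreal_leI sum_mono) auto
    finally show "(\<Sum>j<d. ennreal (r / 2) * indicator {c j - r / 2..c j + r / 2} z)
        \<le> ennreal (indicator {0..1} z * (\<Sum>j<d. tent d j z))"
      by (simp add: sum_distrib_left)
  qed
  finally show ?thesis .
qed


section \<open>The perturbed laws\<close>

definition pair_sign :: "nat \<Rightarrow> nat \<Rightarrow> real" where
  "pair_sign m x = (if x \<in> {1..2 * m} then if odd x then 1 else -1 else 0)"

text \<open>Pairs are counted from 0. Truncated subtraction also gives x = 0 the index 0, but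
  \<open>pair_sign\<close> is 0 there.\<close>

definition pair_index :: "nat \<Rightarrow> nat" where
  "pair_index x = (x - 1) div 2"

lemma pair_sign_simps:
  assumes "a < m"
  shows "pair_sign m (2 * a + 1) = 1" "pair_sign m (2 * a + 2) = -1"
  using assms by (auto simp: pair_sign_def)

lemma pair_index_simps: "pair_index (2 * a + 1) = a" "pair_index (2 * a + 2) = a"
  by (auto simp: pair_index_def)

lemma pair_index_less: "pair_sign m x \<noteq> 0 \<Longrightarrow> pair_index x < m"
  by (auto simp: pair_sign_def pair_index_def split: if_splits)

text \<open>The two members of a pair share their index and have opposite signs: they cancel in the
  first sum and count twice in the second. For odd l the last value has sign 0.\<close>

lemma sum_pair_sign:
  shows "(\<Sum>x\<in>{1..l}. pair_sign (l div 2) x * g (pair_index x)) = 0"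
    and "(\<Sum>x\<in>{1..l}. (pair_sign (l div 2) x)\<^sup>2 * g (pair_index x)) = 2 * (\<Sum>a<l div 2. g a)"
proof -
  have "(\<Sum>x\<in>{1..l}. pair_sign (l div 2) x * g (pair_index x))
      = (\<Sum>x\<in>{1..2 * (l div 2)}. pair_sign (l div 2) x * g (pair_index x))"
    by (rule sum.mono_neutral_right) (auto simp: pair_sign_def)
  also have "\<dots> = (\<Sum>a<l div 2. 0)"
    unfolding sum_pairs
  proof (rule sum.cong[OF refl])
    fix a assume "a \<in> {..<l div 2}"
    then have a: "a < l div 2" by simp
    show "pair_sign (l div 2) (2 * a + 1) * g (pair_index (2 * a + 1))
        + pair_sign (l div 2) (2 * a + 2) * g (pair_index (2 * a + 2)) = 0"
      unfolding pair_sign_simps[OF a] pair_index_simps by simp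
  qed
  finally show "(\<Sum>x\<in>{1..l}. pair_sign (l div 2) x * g (pair_index x)) = 0" by simp
  have "(\<Sum>x\<in>{1..l}. (pair_sign (l div 2) x)\<^sup>2 * g (pair_index x))
      = (\<Sum>x\<in>{1..2 * (l div 2)}. (pair_sign (l div 2) x)\<^sup>2 * g (pair_index x))"
    by (rule sum.mono_neutral_right) (auto simp: pair_sign_def)
  also have "\<dots> = (\<Sum>a<l div 2. 2 * g a)"
    unfolding sum_pairs
  proof (rule sum.cong[OF refl])
    fix a assume "a \<in> {..<l div 2}"
    then have a: "a < l div 2" by simp
    show "(pair_sign (l div 2) (2 * a + 1))\<^sup>2 * g (pair_index (2 * a + 1))
        + (pair_sign (l div 2) (2 * a + 2))\<^sup>2 * g (pair_index (2 * a + 2)) = 2 * g a"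
      unfolding pair_sign_simps[OF a] pair_index_simps by simp
  qed
  finally show "(\<Sum>x\<in>{1..l}. (pair_sign (l div 2) x)\<^sup>2 * g (pair_index x)) = 2 * (\<Sum>a<l div 2. g a)"
    by (simp add: sum_distrib_left)
qed

locale perturbation =
  fixes l1 l2 d :: nat and \<eta> :: real
  assumes l1: "l1 \<ge> 2" and l2: "l2 \<ge> 2" and d: "d \<ge> 1" and \<eta>: "0 < \<eta>" "\<eta> \<le> 1"
begin

text \<open>
  Cell $(a,b,j)$ is the block $\{2a+1,2a+2\} \times \{2b+1,2b+2\}$ over the bin $[j/d,(j+1)/d]$; for odd
  $\ell_1$ or $\ell_2$ the last row or column belongs to no cell and stays unperturbed.
\<close>

definition cells :: "(nat \<times> nat \<times> nat) set" where
  "cells = {..<l1 div 2} \<times> {..<l2 div 2} \<times> {..<d}"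

definition sign_vectors :: "(nat \<times> nat \<times> nat \<Rightarrow> real) set" where
  "sign_vectors = PiE cells (\<lambda>_. {-1, 1})"

definition perturb :: "(nat \<times> nat \<times> nat \<Rightarrow> real) \<Rightarrow> nat \<Rightarrow> nat \<Rightarrow> real \<Rightarrow> real" where
  "perturb w x y z = \<eta> * (pair_sign (l1 div 2) x * pair_sign (l2 div 2) y *
     (\<Sum>j<d. w (pair_index x, pair_index y, j) * tent d j z))"

abbreviation R :: "(nat \<times> nat) set" where
  "R \<equiv> {1..l1} \<times> {1..l2}"

abbreviation N :: real where
  "N \<equiv> real l1 * real l2"

definition null_kernel :: "real \<Rightarrow> (nat \<times> nat) pmf" where
  "null_kernel z = pair_pmf (pmf_of_set {1..l1}) (pmf_of_set {1..l2})"

text \<open>The argument is shown to be a mass function for w in \<open>sign_vectors\<close>, where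
  the perturbation stays within 1/2; facts about this kernel carry that hypothesis.\<close>

definition alt_kernel :: "(nat \<times> nat \<times> nat \<Rightarrow> real) \<Rightarrow> real \<Rightarrow> (nat \<times> nat) pmf" where
  "alt_kernel w z = embed_pmf (\<lambda>(x, y). indicator R (x, y) * (1 + perturb w x y z) / N)"

abbreviation unif :: "real \<Rightarrow> real" where
  "unif \<equiv> indicator {0..1}"

definition p0 :: "(nat \<times> nat \<times> real) measure" where
  "p0 = joint_law unif null_kernel"

definition p1 :: "(nat \<times> nat \<times> nat \<Rightarrow> real) \<Rightarrow> (nat \<times> nat \<times> real) measure" where
  "p1 w = joint_law unif (alt_kernel w)"

lemma finite_cells: "finite cells" by (simp add: cells_def)

lemma finite_sign_vectors: "finite sign_vectors" and sign_vectors_nonempty: "sign_vectors \<noteq> {}"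
  by (auto simp: sign_vectors_def finite_cells PiE_eq_empty_iff intro!: finite_PiE)

lemma N_pos: "N > 0" using l1 l2 by simp

lemma abs_sign: "w \<in> sign_vectors \<Longrightarrow> k \<in> cells \<Longrightarrow> \<bar>w k\<bar> = 1"
  using PiE_mem[of w cells "\<lambda>_. {-1, 1}" k] by (auto simp: sign_vectors_def)

lemma abs_sign_pair_index:
  assumes "w \<in> sign_vectors" "pair_sign (l1 div 2) x \<noteq> 0" "pair_sign (l2 div 2) y \<noteq> 0" "j < d"
  shows "\<bar>w (pair_index x, pair_index y, j)\<bar> = 1"
  using assms by (intro abs_sign) (auto simp: cells_def pair_index_less)

lemma perturb_cases:
  obtains "pair_sign (l1 div 2) x \<noteq> 0" "pair_sign (l2 div 2) y \<noteq> 0"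
      "\<bar>pair_sign (l1 div 2) x * pair_sign (l2 div 2) y\<bar> = 1"
  | "\<And>w z. perturb w x y z = 0"
  by (cases "pair_sign (l1 div 2) x = 0 \<or> pair_sign (l2 div 2) y = 0")
    (auto simp: perturb_def pair_sign_def split: if_splits)

lemma perturb_bound:
  assumes w: "w \<in> sign_vectors"
  shows "\<bar>perturb w x y z\<bar> \<le> 1/2"
proof (cases rule: perturb_cases[of x y])
  case 1
  have "\<bar>perturb w x y z\<bar> = \<eta> * (\<Sum>j<d. tent d j z)"
    using 1 abs_sign_pair_index[OF w 1(1,2)] \<eta> by (simp add: perturb_def abs_mult tent_sum_abs[OF d])
  also have "\<dots> \<le> 1 * (1/2)"
    using \<eta> by (intro mult_mono tent_sum_le[OF d] sum_nonneg tent_nonneg) auto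
  finally show ?thesis by simp
qed simp

lemma perturb_lipschitz:
  assumes w: "w \<in> sign_vectors"
  shows "\<bar>perturb w x y z - perturb w x y z'\<bar> \<le> \<eta> * \<bar>z - z'\<bar>"
proof (cases rule: perturb_cases[of x y])
  case 1
  have "\<bar>perturb w x y z - perturb w x y z'\<bar> = \<eta> * \<bar>(\<Sum>j<d. w (pair_index x, pair_index y, j) * tent d j z)
      - (\<Sum>j<d. w (pair_index x, pair_index y, j) * tent d j z')\<bar>"
    using 1(3) \<eta> by (simp add: perturb_def abs_mult flip: right_diff_distrib)
  also have "\<dots> \<le> \<eta> * \<bar>z - z'\<bar>"
    using \<eta> abs_sign_pair_index[OF w 1(1,2)] by (intro mult_left_mono tent_sum_lipschitz[OF d]) auto
  finally show ?thesis .
next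
  case 2
  then show ?thesis using \<eta> by simp
qed

lemma perturb_measurable [measurable]: "perturb w x y \<in> borel_measurable borel"
  unfolding perturb_def by measurable

text \<open>Already each row sums to zero, by the sign change inside the column pairs. Thus the
  factor \<open>1 + perturb w x y z\<close> preserves the mass at every z, and Z stays
  uniform.\<close>

lemma sum_perturb: "(\<Sum>x\<in>{1..l1}. \<Sum>y\<in>{1..l2}. perturb w x y z) = 0"
proof -
  have "(\<Sum>y\<in>{1..l2}. perturb w x y z) = 0" for x
  proof -
    have "perturb w x y z = \<eta> * pair_sign (l1 div 2) x *
        (pair_sign (l2 div 2) y * (\<Sum>j<d. w (pair_index x, pair_index y, j) * tent d j z))" for y
      by (simp add: perturb_def mult_ac)
    then show ?thesis
      using sum_pair_sign(1)[of l2 "\<lambda>b. \<Sum>j<d. w (pair_index x, b, j) * tent d j z"]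
      by (simp flip: sum_distrib_left)
  qed
  then show ?thesis by simp
qed

text \<open>The checkerboard signs are squared away and the cross terms between bins vanish, so only
  the products of cell signs survive. The 4 counts the entries of a block.\<close>

lemma sum_perturb_mult:
  "(\<Sum>x\<in>{1..l1}. \<Sum>y\<in>{1..l2}. perturb w x y z * perturb w' x y z)
    = 4 * \<eta>\<^sup>2 * (\<Sum>k\<in>cells. w k * w' k * (tent d (snd (snd k)) z)\<^sup>2)"
proof -
  let ?F = "\<lambda>a b. \<Sum>j<d. w (a, b, j) * w' (a, b, j) * (tent d j z)\<^sup>2"
  have "perturb w x y z * perturb w' x y z = \<eta>\<^sup>2 * ((pair_sign (l1 div 2) x)\<^sup>2 *
      ((pair_sign (l2 div 2) y)\<^sup>2 * ?F (pair_index x) (pair_index y)))" for x y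
    unfolding perturb_def tent_sum_mult[OF d, symmetric] by (simp add: power2_eq_square mult_ac)
  then have "(\<Sum>x\<in>{1..l1}. \<Sum>y\<in>{1..l2}. perturb w x y z * perturb w' x y z)
      = \<eta>\<^sup>2 * (\<Sum>x\<in>{1..l1}. (pair_sign (l1 div 2) x)\<^sup>2 *
          (\<Sum>y\<in>{1..l2}. (pair_sign (l2 div 2) y)\<^sup>2 * ?F (pair_index x) (pair_index y)))"
    by (simp add: sum_distrib_left)
  also have "\<dots> = \<eta>\<^sup>2 * (\<Sum>x\<in>{1..l1}. (pair_sign (l1 div 2) x)\<^sup>2 * (\<lambda>a. 2 * (\<Sum>b<l2 div 2. ?F a b)) (pair_index x))"
    by (subst sum_pair_sign(2)) simp
  also have "\<dots> = \<eta>\<^sup>2 * (2 * (\<Sum>a<l1 div 2. 2 * (\<Sum>b<l2 div 2. ?F a b)))"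
    by (simp only: sum_pair_sign(2)[of l1 "\<lambda>a. 2 * (\<Sum>b<l2 div 2. ?F a b)"])
  also have "\<dots> = 4 * \<eta>\<^sup>2 * (\<Sum>a<l1 div 2. \<Sum>b<l2 div 2. ?F a b)"
    by (simp flip: sum_distrib_left)
  also have "(\<Sum>a<l1 div 2. \<Sum>b<l2 div 2. ?F a b) = (\<Sum>k\<in>cells. w k * w' k * (tent d (snd (snd k)) z)\<^sup>2)"
    unfolding cells_def by (simp add: sum.cartesian_product case_prod_unfold)
  finally show ?thesis .
qed

lemma pmf_null_kernel: "pmf (null_kernel z) v = indicator R v / N"
  using l1 l2 by (cases v) (auto simp: null_kernel_def pmf_pair split: split_indicator)

lemma set_null_kernel: "set_pmf (null_kernel z) = R"
  using l1 l2 by (simp add: null_kernel_def)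

lemma pmf_alt_kernel:
  assumes w: "w \<in> sign_vectors"
  shows "pmf (alt_kernel w z) (x, y) = indicator R (x, y) * (1 + perturb w x y z) / N"
proof -
  have nn: "0 \<le> indicator R (x, y) * (1 + perturb w x y z) / N" for x y
    using perturb_bound[OF w, of x y z] N_pos by (auto split: split_indicator)
  have "(\<integral>\<^sup>+ v. ennreal (case v of (x, y) \<Rightarrow> indicator R (x, y) * (1 + perturb w x y z) / N) \<partial>count_space UNIV)
      = (\<Sum>v\<in>R. ennreal (case v of (x, y) \<Rightarrow> indicator R (x, y) * (1 + perturb w x y z) / N))"
  proof (rule nn_integral_count_space')
    fix v assume "v \<notin> R"
    then show "ennreal (case v of (x, y) \<Rightarrow> indicator R (x, y) * (1 + perturb w x y z) / N) = 0"
      by (cases v) (simp del: mem_Sigma_iff)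
  qed auto
  also have "\<dots> = ennreal (\<Sum>v\<in>R. case v of (x, y) \<Rightarrow> indicator R (x, y) * (1 + perturb w x y z) / N)"
    by (rule sum_ennreal) (use nn in auto)
  also have "(\<Sum>v\<in>R. case v of (x, y) \<Rightarrow> indicator R (x, y) * (1 + perturb w x y z) / N)
      = (\<Sum>x\<in>{1..l1}. \<Sum>y\<in>{1..l2}. 1 + perturb w x y z) / N"
    unfolding sum_divide_distrib sum.cartesian_product by (intro sum.cong) auto
  also have "\<dots> = 1" using l1 l2 by (simp add: sum.distrib sum_perturb del: One_nat_def)
  finally show ?thesis unfolding alt_kernel_def
    by (subst pmf_embed_pmf) (use nn in auto)
qed

lemma set_alt_kernel:
  assumes w: "w \<in> sign_vectors"
  shows "set_pmf (alt_kernel w z) \<subseteq> R"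
  using N_pos by (auto simp: set_pmf_iff pmf_alt_kernel[OF w] indicator_def split: if_splits)

lemma kernel_unifI:
  assumes "\<And>v. (\<lambda>z. pmf (\<kappa> z) v) \<in> borel_measurable borel"
  shows "kernel unif \<kappa>"
proof
  show "(\<integral>\<^sup>+ z. ennreal (unif z) \<partial>lborel) = 1" by (simp add: ennreal_indicator)
qed (use measurable_kernelI[OF assms] in auto)

lemma kernel_null: "kernel unif null_kernel"
  by (rule kernel_unifI) (simp add: pmf_null_kernel)

lemma kernel_alt: "w \<in> sign_vectors \<Longrightarrow> kernel unif (alt_kernel w)"
proof (rule kernel_unifI)
  fix v assume "w \<in> sign_vectors"
  then show "(\<lambda>z. pmf (alt_kernel w z) v) \<in> borel_measurable borel"
    by (cases v) (simp add: pmf_alt_kernel)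
qed

section \<open>The null law lies in the null classes\<close>

lemma p0_in_P01: "p0 \<in> P01 l1 l2"
proof -
  interpret kernel unif null_kernel by (rule kernel_null)
  have "p0 \<in> E01 l1 l2"
    unfolding p0_def by (rule joint_law_in_E01) (auto simp: set_null_kernel)
  then show ?thesis
    unfolding P01_def using cond_version_joint_law
    by (auto simp: p0_def null_kernel_def intro!: exI[of _ null_kernel] indep_var_pair_pmf)
qed

text \<open>The null kernel does not depend on z, so each of the distances in the three smoothness
  conditions is 0.\<close>

lemma p0_in_null:
  assumes "H0 \<in> {P01_TV L, P01_TV2 L, P01_chi2 L}"
  shows "p0 \<in> H0 l1 l2"
proof -
  interpret kernel unif null_kernel by (rule kernel_null)
  have const: "null_kernel z = null_kernel z'" for z z' by (simp add: null_kernel_def)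
  have c: "cond_version p0 null_kernel" using cond_version_joint_law by (simp add: p0_def)
  have l1d: "l1_dist (measure_pmf (map_pmf f (null_kernel z))) (measure_pmf (map_pmf f (null_kernel z'))) = 0"
    for f :: "nat \<times> nat \<Rightarrow> nat" and z z'
    unfolding const[of z z'] by (rule l1_dist_self)
  have chi: "chi2_div (measure_pmf (map_pmf f (null_kernel z))) (measure_pmf (map_pmf f (null_kernel z'))) = 0"
    for f :: "nat \<times> nat \<Rightarrow> nat" and z z'
    unfolding const[of z z'] by (rule chi2_div_self)
  from assms show ?thesis
    unfolding P01_TV_def P01_TV2_def P01_chi2_def using p0_in_P01 c
    by (auto simp: l1d chi intro!: exI[of _ null_kernel])
qed

section \<open>Likelihood ratios and their second moment\<close>

definition likelihood_ratio :: "(nat \<times> nat \<times> nat \<Rightarrow> real) \<Rightarrow> nat \<times> nat \<times> real \<Rightarrow> real" where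
  "likelihood_ratio w = (\<lambda>(x, y, z). 1 + perturb w x y z)"

lemma likelihood_ratio_nonneg: "w \<in> sign_vectors \<Longrightarrow> 0 \<le> likelihood_ratio w t"
  using perturb_bound[of w "fst t" "fst (snd t)" "snd (snd t)"] by (auto simp: likelihood_ratio_def case_prod_unfold)

lemma likelihood_ratio_measurable: "likelihood_ratio w \<in> borel_measurable obs_space"
  unfolding likelihood_ratio_def by (rule measurable_obs_spaceI) simp

lemma p0_density_measurable: "(\<lambda>t. ennreal (case t of (x, y, z) \<Rightarrow> unif z * pmf (null_kernel z) (x, y))) \<in> borel_measurable obs_space"
  using kernel.density_measurable[OF kernel_null] by simp

lemma sets_p0: "sets p0 = sets obs_space"
  unfolding p0_def by (rule kernel.sets_joint_law[OF kernel_null])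

lemma p1_density:
  assumes w: "w \<in> sign_vectors"
  shows "p1 w = density p0 (likelihood_ratio w)"
proof -
  have "density p0 (likelihood_ratio w) = density base_measure
      (\<lambda>t. ennreal (case t of (x, y, z) \<Rightarrow> unif z * pmf (null_kernel z) (x, y)) * ennreal (likelihood_ratio w t))"
    unfolding p0_def joint_law_def
    by (rule density_density_eq) (use p0_density_measurable likelihood_ratio_measurable in \<open>simp_all add: measurable_base_measure_eq\<close>)
  also have "\<dots> = p1 w"
    unfolding p1_def joint_law_def
  proof (rule arg_cong[where f="density base_measure"], rule ext)
    fix t :: "nat \<times> nat \<times> real"
    obtain x y z where t: "t = (x, y, z)" by (cases t)
    show "ennreal (case t of (x, y, z) \<Rightarrow> unif z * pmf (null_kernel z) (x, y)) * ennreal (likelihood_ratio w t)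
        = ennreal (case t of (x, y, z) \<Rightarrow> unif z * pmf (alt_kernel w z) (x, y))"
      using likelihood_ratio_nonneg[OF w, of t] N_pos
      by (subst ennreal_mult[symmetric]) (auto simp: t likelihood_ratio_def pmf_alt_kernel[OF w] pmf_null_kernel)
  qed
  finally show ?thesis by simp
qed

lemma p1_prob: "w \<in> sign_vectors \<Longrightarrow> prob_space (p1 w)"
  unfolding p1_def by (rule kernel.prob_space_joint_law[OF kernel_alt])

lemma likelihood_ratio_integral:
  assumes w: "w \<in> sign_vectors"
  shows "(\<integral>\<^sup>+ t. likelihood_ratio w t \<partial>p0) = 1"
proof -
  have "(\<integral>\<^sup>+ t. likelihood_ratio w t \<partial>p0) = emeasure (p1 w) (space (p1 w))"
    unfolding p1_density[OF w]
    using likelihood_ratio_measurable by (subst emeasure_density) (auto simp: measurable_cong_sets[OF sets_p0 refl] cong: nn_integral_cong)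
  then show ?thesis using prob_space.emeasure_space_1[OF p1_prob[OF w]] by simp
qed

text \<open>Up to the sign \<open>w k * w' k\<close>, the part of the covariance under
  \<open>p0\<close> of two likelihood ratios that comes from cell k: four entries of null mass 1/N,
  each with squared amplitude \<open>(\<eta> * tent)^2\<close>.\<close>

definition cell_energy :: "nat \<times> nat \<times> nat \<Rightarrow> real" where
  "cell_energy k = 4 * \<eta>\<^sup>2 / N * (\<integral>z. unif z * (tent d (snd (snd k)) z)\<^sup>2 \<partial>lborel)"

lemma abs_cell_energy_le: "\<bar>cell_energy k\<bar> \<le> 1 / (N * real d ^ 3)"
proof -
  have "\<eta>\<^sup>2 \<le> 1" using \<eta> by (simp add: power_le_one)
  have "\<bar>cell_energy k\<bar> = 4 * \<eta>\<^sup>2 / N * \<bar>\<integral>z. unif z * (tent d (snd (snd k)) z)\<^sup>2 \<partial>lborel\<bar>"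
    using N_pos by (simp add: cell_energy_def abs_mult)
  also have "\<dots> \<le> 4 * 1 / N * (1 / (4 * real d ^ 3))"
    using N_pos \<open>\<eta>\<^sup>2 \<le> 1\<close> by (intro mult_mono divide_right_mono tent_square_integral(2)[OF d]) auto
  finally show ?thesis by simp
qed

text \<open>The integral equals 1 plus the signed sum of energies, since the linear terms vanish by
  \<open>sum_perturb\<close>. Passing from 1 + s to exp s makes its n-th power a product over cells,
  the form that \<open>signs_average_le\<close> needs.\<close>

lemma likelihood_ratio_inner_product:
  assumes w: "w \<in> sign_vectors" and w': "w' \<in> sign_vectors"
  shows "(\<integral>\<^sup>+ t. ennreal (likelihood_ratio w t * likelihood_ratio w' t) \<partial>p0) \<le> ennreal (exp (\<Sum>k\<in>cells. cell_energy k * w k * w' k))"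
proof -
  \<comment> \<open>G is the inner product conditional on Z = z.\<close>
  define G where "G z = 1 + 4 * \<eta>\<^sup>2 / N * (\<Sum>k\<in>cells. w k * w' k * (tent d (snd (snd k)) z)\<^sup>2)" for z
  have rr: "0 \<le> (1 + perturb w x y z) * (1 + perturb w' x y z)" for x y z
    using likelihood_ratio_nonneg[OF w, of "(x, y, z)"] likelihood_ratio_nonneg[OF w', of "(x, y, z)"] by (simp add: likelihood_ratio_def)
  have "(\<Sum>x\<in>{1..l1}. \<Sum>y\<in>{1..l2}. (1 + perturb w x y z) * (1 + perturb w' x y z))
      = (\<Sum>x\<in>{1..l1}. \<Sum>y\<in>{1..l2}. 1 + perturb w x y z + perturb w' x y z + perturb w x y z * perturb w' x y z)" for z
    by (intro sum.cong refl) (simp add: algebra_simps)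
  also have "\<dots> z = N + 4 * \<eta>\<^sup>2 * (\<Sum>k\<in>cells. w k * w' k * (tent d (snd (snd k)) z)\<^sup>2)" for z
    by (simp add: sum.distrib sum_perturb sum_perturb_mult del: One_nat_def)
  finally have G: "(\<Sum>x\<in>{1..l1}. \<Sum>y\<in>{1..l2}. (1 + perturb w x y z) * (1 + perturb w' x y z)) / N = G z" for z
    using l1 l2 by (simp add: G_def add_divide_distrib)
  then have G0: "0 \<le> G z" for z
    unfolding G[symmetric] using N_pos rr by (intro divide_nonneg_pos sum_nonneg) auto
  let ?f = "\<lambda>t. ennreal (case t of (x, y, z) \<Rightarrow> unif z * pmf (null_kernel z) (x, y)) * ennreal (likelihood_ratio w t * likelihood_ratio w' t)"
  have m: "?f \<in> borel_measurable obs_space"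
    using p0_density_measurable likelihood_ratio_measurable by measurable
  have "(\<integral>\<^sup>+ t. ennreal (likelihood_ratio w t * likelihood_ratio w' t) \<partial>p0) = (\<integral>\<^sup>+ t. ?f t \<partial>base_measure)"
    unfolding p0_def joint_law_def
    by (rule nn_integral_density)
      (use p0_density_measurable likelihood_ratio_measurable in \<open>simp_all add: measurable_base_measure_eq\<close>)
  also have "\<dots> = (\<integral>\<^sup>+ z. \<integral>\<^sup>+ v. ?f (fst v, snd v, z) \<partial>count_space UNIV \<partial>lborel)"
    by (rule nn_integral_base_measure[OF m])
  also have "\<dots> = (\<integral>\<^sup>+ z. ennreal (unif z * G z) \<partial>lborel)"
  proof (rule nn_integral_cong)
    fix z
    have "(\<integral>\<^sup>+ v. ?f (fst v, snd v, z) \<partial>count_space UNIV) = (\<Sum>v\<in>R. ?f (fst v, snd v, z))"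
      by (rule nn_integral_count_space') (auto simp: pmf_null_kernel)
    also have "\<dots> = (\<Sum>v\<in>R. ennreal (unif z * ((1 + perturb w (fst v) (snd v) z) * (1 + perturb w' (fst v) (snd v) z) / N)))"
      using N_pos rr
      by (intro sum.cong refl) (auto simp: pmf_null_kernel likelihood_ratio_def simp flip: ennreal_mult)
    also have "\<dots> = ennreal (\<Sum>v\<in>R. unif z * ((1 + perturb w (fst v) (snd v) z) * (1 + perturb w' (fst v) (snd v) z) / N))"
      using N_pos rr by (intro sum_ennreal) auto
    also have "(\<Sum>v\<in>R. unif z * ((1 + perturb w (fst v) (snd v) z) * (1 + perturb w' (fst v) (snd v) z) / N)) = unif z * G z"
      unfolding G[symmetric] sum_divide_distrib sum_distrib_left sum.cartesian_product
      by (intro sum.cong) auto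
    finally show "(\<integral>\<^sup>+ v. ?f (fst v, snd v, z) \<partial>count_space UNIV) = ennreal (unif z * G z)" .
  qed
  also have "\<dots> = ennreal (\<integral>z. unif z * G z \<partial>lborel)"
  proof -
    have *: "unif z * G z = unif z + (\<Sum>k\<in>cells. 4 * \<eta>\<^sup>2 / N * (w k * w' k) * (unif z * (tent d (snd (snd k)) z)\<^sup>2))" for z
      by (simp add: G_def algebra_simps sum_distrib_left)
    have "integrable lborel (\<lambda>z. unif z + (\<Sum>k\<in>cells. 4 * \<eta>\<^sup>2 / N * (w k * w' k) * (unif z * (tent d (snd (snd k)) z)\<^sup>2)))"
      by (intro Bochner_Integration.integrable_add Bochner_Integration.integrable_sum integrable_mult_right
        tent_square_integral(1)[OF d]) (auto intro!: integrable_real_indicator)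
    then have "integrable lborel (\<lambda>z. unif z * G z)" by (simp only: *)
    then show ?thesis using G0 by (intro nn_integral_eq_integral) auto
  qed
  also have "(\<integral>z. unif z * G z \<partial>lborel) = 1 + (\<Sum>k\<in>cells. cell_energy k * w k * w' k)"
  proof -
    have "(\<integral>z. unif z * G z \<partial>lborel)
        = (\<integral>z. unif z + (\<Sum>k\<in>cells. 4 * \<eta>\<^sup>2 / N * (w k * w' k) * (unif z * (tent d (snd (snd k)) z)\<^sup>2)) \<partial>lborel)"
      by (intro Bochner_Integration.integral_cong refl) (simp add: G_def algebra_simps sum_distrib_left)
    also have "\<dots> = (\<integral>z. unif z \<partial>lborel) + (\<integral>z. (\<Sum>k\<in>cells. 4 * \<eta>\<^sup>2 / N * (w k * w' k) * (unif z * (tent d (snd (snd k)) z)\<^sup>2)) \<partial>lborel)"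
      by (intro Bochner_Integration.integral_add Bochner_Integration.integrable_sum integrable_mult_right
        tent_square_integral(1)[OF d]) (auto intro!: integrable_real_indicator)
    also have "(\<integral>z. unif z \<partial>lborel) = 1" by simp
    also have "(\<integral>z. (\<Sum>k\<in>cells. 4 * \<eta>\<^sup>2 / N * (w k * w' k) * (unif z * (tent d (snd (snd k)) z)\<^sup>2)) \<partial>lborel)
        = (\<Sum>k\<in>cells. 4 * \<eta>\<^sup>2 / N * (w k * w' k) * (\<integral>z. unif z * (tent d (snd (snd k)) z)\<^sup>2 \<partial>lborel))"
      by (subst Bochner_Integration.integral_sum)
        (auto intro!: integrable_mult_right tent_square_integral(1)[OF d])
    finally show ?thesis by (simp add: cell_energy_def mult_ac)
  qed
  also have "ennreal \<dots> \<le> ennreal (exp (\<Sum>k\<in>cells. cell_energy k * w k * w' k))"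
    by (intro ennreal_leI exp_ge_add_one_self)
  finally show ?thesis .
qed

lemma card_cells_le: "real (card cells) \<le> N * real d / 4"
proof -
  have "real (l1 div 2) * real (l2 div 2) \<le> (real l1 / 2) * (real l2 / 2)"
    by (intro mult_mono) auto
  then have "real (l1 div 2) * real (l2 div 2) * real d \<le> (real l1 / 2) * (real l2 / 2) * real d"
    by (rule mult_right_mono) simp
  then show ?thesis by (simp add: cells_def mult_ac)
qed

lemma second_moment:
  assumes n: "(real n)\<^sup>2 \<le> N * real d ^ 5"
  shows "(\<Sum>w\<in>sign_vectors. \<Sum>w'\<in>sign_vectors. (\<integral>\<^sup>+ t. ennreal (likelihood_ratio w t * likelihood_ratio w' t) \<partial>p0) ^ n) \<le> ennreal (2 * (real (card sign_vectors))\<^sup>2)"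
proof -
  \<comment> \<open>The n-th power multiplies every energy by n; B bounds the result for all
    cells.\<close>
  define B where "B = real n * (1 / (N * real d ^ 3))"
  have "(\<Sum>w\<in>sign_vectors. \<Sum>w'\<in>sign_vectors. (\<integral>\<^sup>+ t. ennreal (likelihood_ratio w t * likelihood_ratio w' t) \<partial>p0) ^ n)
      \<le> (\<Sum>w\<in>sign_vectors. \<Sum>w'\<in>sign_vectors. ennreal (exp (\<Sum>k\<in>cells. cell_energy k * w k * w' k)) ^ n)"
    by (intro sum_mono power_mono likelihood_ratio_inner_product) auto
  also have "\<dots> = ennreal (\<Sum>w\<in>sign_vectors. \<Sum>w'\<in>sign_vectors. exp (\<Sum>k\<in>cells. (real n * cell_energy k) * w k * w' k))"
    by (simp add: ennreal_power sum_nonneg sum_distrib_left mult_ac flip: exp_of_nat_mult)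
  also have "\<dots> \<le> ennreal (exp (card cells * B\<^sup>2 / 2) * (real (card sign_vectors))\<^sup>2)"
    unfolding sign_vectors_def
    by (intro ennreal_leI signs_average_le finite_cells)
      (auto simp: B_def abs_mult simp del: times_divide_eq_right intro!: mult_left_mono abs_cell_energy_le)
  also have "\<dots> \<le> ennreal (2 * (real (card sign_vectors))\<^sup>2)"
  proof (intro ennreal_leI mult_right_mono)
    have d0: "real d > 0" using d by simp
    have "card cells * B\<^sup>2 / 2 \<le> (N * real d / 4) * B\<^sup>2 / 2"
      by (intro divide_right_mono mult_right_mono card_cells_le) auto
    also have "\<dots> = (real n)\<^sup>2 / (8 * (N * real d ^ 5))"
      using N_pos d0 by (simp add: B_def power2_eq_square field_simps eval_nat_numeral)
    \<comment> \<open>The hypothesis on n even gives 1/8; the bound 1/2 is taken because exp (1/2)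
      \<le> 2.\<close>
    also have "\<dots> \<le> 1 / 2"
    proof -
      define T where "T = N * real d ^ 5"
      have "T > 0" using N_pos d0 by (simp add: T_def)
      then show ?thesis using n by (simp add: T_def[symmetric] divide_le_eq)
    qed
    finally have "exp (card cells * B\<^sup>2 / 2) \<le> exp (1/2)" by simp
    also have "\<dots> \<le> (2::real)" by (rule exp_half_le2)
    finally show "exp (card cells * B\<^sup>2 / 2) \<le> 2" .
  qed simp
  finally show ?thesis .
qed

section \<open>Distance from conditional independence\<close>

lemma block_count: "1/9 \<le> real (l1 div 2) * real (l2 div 2) / N"
proof -
  \<comment> \<open>The worst case is l = 3, where one of three values stays unpaired.\<close>
  have "real l / 3 \<le> real (l div 2)" if "l \<ge> 2" for l
  proof -
    have "l \<le> 3 * (l div 2)" using that by linarith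
    then show ?thesis by linarith
  qed
  then have "(real l1 / 3) * (real l2 / 3) \<le> real (l1 div 2) * real (l2 div 2)"
    using l1 l2 by (intro mult_mono) auto
  then show ?thesis using N_pos by (simp add: field_simps)
qed

text \<open>By \<open>rank_one_distance\<close> each block contributes at least \<eta> / N times the
  tent sum at z. There are at least N / 9 blocks, and the tent sum integrates to at least 1 / (8d);
  hence 72 = 9 * 8.\<close>

lemma p1_separation:
  assumes w: "w \<in> sign_vectors" and q: "q \<in> P01 l1 l2"
  shows "ennreal (\<eta> / (72 * real d)) \<le> l1_dist (p1 w) q"
proof -
  obtain \<kappa> where \<kappa>: "cond_version q \<kappa>" and ind: "AE z in Z_law q. prob_space.indep_var (measure_pmf (\<kappa> z))
        (count_space UNIV) fst (count_space UNIV) snd" and qE: "q \<in> E01 l1 l2"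
    using q by (auto simp: P01_def)
  obtain h where k: "kernel h \<kappa>" and qj: "q = joint_law h \<kappa>" and Z: "Z_law q = density lborel h"
    using E01_joint_law[OF qE \<kappa>] by blast
  interpret k: kernel h \<kappa> by fact
  let ?I = "\<lambda>z. \<integral>\<^sup>+ v. ennreal \<bar>unif z * pmf (alt_kernel w z) v - h z * pmf (\<kappa> z) v\<bar> \<partial>count_space UNIV"
  define C where "C = real (l1 div 2) * real (l2 div 2) * (\<eta> / N)"
  have C: "C \<ge> \<eta> / 9" using mult_right_mono[OF block_count, of \<eta>] \<eta> by (simp add: C_def mult_ac)
  have C0: "C \<ge> 0" using C \<eta> by simp
  \<comment> \<open>Independence is given almost everywhere for the law of Z. For Lebesgue measure
    this says something only where h is positive.\<close>
  have "AE z in lborel. 0 < ennreal (h z) \<longrightarrow> prob_space.indep_var (measure_pmf (\<kappa> z))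
        (count_space UNIV) fst (count_space UNIV) snd"
    using ind unfolding Z by (subst (asm) AE_density) auto
  then have "AE z in lborel. ennreal (C * (unif z * (\<Sum>j<d. tent d j z))) \<le> ?I z"
  proof (rule eventually_mono)
    fix z assume indz: "0 < ennreal (h z) \<longrightarrow> prob_space.indep_var (measure_pmf (\<kappa> z))
        (count_space UNIV) fst (count_space UNIV) snd"
    define Q where "Q x y = h z * pmf (\<kappa> z) (x, y)" for x y
    have Q0: "0 \<le> Q x y" for x y using k.h_nonneg by (simp add: Q_def)
    \<comment> \<open>Where h vanishes the kernel may be dependent, but there the block of densities
      is zero and hence singular too.\<close>
    have rank: "Q x y * Q x' y' = Q x y' * Q x' y" for x y x' y'
    proof (cases "h z = 0")
      case False
      then have "0 < ennreal (h z)" using k.h_nonneg[of z] by simp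
      from pmf_indep_var[OF indz[rule_format, OF this]] show ?thesis by (simp add: Q_def)
    qed (simp add: Q_def)
    show "ennreal (C * (unif z * (\<Sum>j<d. tent d j z))) \<le> ?I z"
    proof (cases "z \<in> {0..1}")
      case True
      define g where "g x y = \<bar>pmf (alt_kernel w z) (x, y) - Q x y\<bar>" for x y
      let ?m1 = "l1 div 2" and ?m2 = "l2 div 2"
      let ?F = "{1..2 * ?m1} \<times> {1..2 * ?m2}"
      have block: "\<eta> / N * (\<Sum>j<d. tent d j z) \<le> g (2 * a + 1) (2 * b + 1) + g (2 * a + 1) (2 * b + 2)
          + g (2 * a + 2) (2 * b + 1) + g (2 * a + 2) (2 * b + 2)" if a: "a < ?m1" and b: "b < ?m2" for a b
      proof -
        define U where "U = \<eta> * (\<Sum>j<d. w (a, b, j) * tent d j z) / N"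
        have R: "indicat_real R (2 * a + 1, 2 * b + 1) = 1" "indicat_real R (2 * a + 1, 2 * b + 2) = 1"
          "indicat_real R (2 * a + 2, 2 * b + 1) = 1" "indicat_real R (2 * a + 2, 2 * b + 2) = 1"
          using a b by (auto simp: indicator_def)
        have "\<bar>w (a, b, j)\<bar> = 1" if "j < d" for j
          using that a b by (intro abs_sign[OF w]) (auto simp: cells_def)
        then have "\<bar>U\<bar> = \<eta> / N * (\<Sum>j<d. tent d j z)"
          using \<eta> N_pos by (simp add: U_def abs_mult tent_sum_abs[OF d])
        moreover have "pmf (alt_kernel w z) (2 * a + 1, 2 * b + 1) = 1 / N + U"
          "pmf (alt_kernel w z) (2 * a + 1, 2 * b + 2) = 1 / N - U"
          "pmf (alt_kernel w z) (2 * a + 2, 2 * b + 1) = 1 / N - U"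
          "pmf (alt_kernel w z) (2 * a + 2, 2 * b + 2) = 1 / N + U"
          using a b
          by (simp_all only: R pmf_alt_kernel[OF w] perturb_def pair_sign_simps pair_index_simps U_def)
            (simp_all add: add_divide_distrib diff_divide_distrib)
        ultimately show ?thesis
          using rank_one_distance[of "1 / N" "Q (2 * a + 1) (2 * b + 1)" "Q (2 * a + 1) (2 * b + 2)"
              "Q (2 * a + 2) (2 * b + 1)" "Q (2 * a + 2) (2 * b + 2)" U] Q0 rank N_pos
          by (simp only: g_def) simp
      qed
      have "C * (unif z * (\<Sum>j<d. tent d j z)) = (\<Sum>a<?m1. \<Sum>b<?m2. \<eta> / N * (\<Sum>j<d. tent d j z))"
        using True by (simp add: C_def)
      also have "\<dots> \<le> (\<Sum>a<?m1. \<Sum>b<?m2. g (2 * a + 1) (2 * b + 1) + g (2 * a + 1) (2 * b + 2)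
          + g (2 * a + 2) (2 * b + 1) + g (2 * a + 2) (2 * b + 2))"
        by (intro sum_mono block) auto
      also have "\<dots> = (\<Sum>x\<in>{1..2 * ?m1}. \<Sum>y\<in>{1..2 * ?m2}. g x y)"
        unfolding sum_pairs by (simp add: sum.distrib add_ac)
      also have "\<dots> = (\<Sum>v\<in>?F. g (fst v) (snd v))"
        by (simp add: sum.cartesian_product case_prod_unfold)
      finally have "ennreal (C * (unif z * (\<Sum>j<d. tent d j z))) \<le> ennreal (\<Sum>v\<in>?F. g (fst v) (snd v))"
        by (rule ennreal_leI)
      also have "\<dots> = (\<Sum>v\<in>?F. ennreal (g (fst v) (snd v)))"
        by (rule sum_ennreal[symmetric]) (simp add: g_def)
      also have "\<dots> = (\<integral>\<^sup>+ v. ennreal (g (fst v) (snd v)) \<partial>count_space ?F)"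
        by (rule nn_integral_count_space_finite[symmetric]) simp
      also have "\<dots> = (\<integral>\<^sup>+ v. ennreal (g (fst v) (snd v)) * indicator ?F v \<partial>count_space UNIV)"
        by (rule nn_integral_count_space_indicator) simp
      also have "\<dots> \<le> ?I z"
        using True by (intro nn_integral_mono) (auto simp: g_def Q_def split: split_indicator)
      finally show ?thesis .
    qed simp
  qed
  then have "(\<integral>\<^sup>+ z. ennreal (C * (unif z * (\<Sum>j<d. tent d j z))) \<partial>lborel) \<le> (\<integral>\<^sup>+ z. ?I z \<partial>lborel)"
    by (rule nn_integral_mono_AE)
  moreover have "(\<integral>\<^sup>+ z. ennreal (C * (unif z * (\<Sum>j<d. tent d j z))) \<partial>lborel)
      = ennreal C * (\<integral>\<^sup>+ z. ennreal (unif z * (\<Sum>j<d. tent d j z)) \<partial>lborel)"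
    using C0 by (simp add: ennreal_mult'' ennreal_mult' nn_integral_cmult)
  moreover have "ennreal (\<eta> / (72 * real d)) \<le> ennreal C * (\<integral>\<^sup>+ z. ennreal (unif z * (\<Sum>j<d. tent d j z)) \<partial>lborel)"
  proof -
    have "ennreal (\<eta> / (72 * real d)) = ennreal (\<eta> / 9) * ennreal (1 / (8 * real d))"
      using \<eta> by (simp flip: ennreal_mult)
    also have "\<dots> \<le> ennreal C * (\<integral>\<^sup>+ z. ennreal (unif z * (\<Sum>j<d. tent d j z)) \<partial>lborel)"
      using C by (intro mult_mono ennreal_leI tent_sum_integral_ge[OF d]) auto
    finally show ?thesis .
  qed
  ultimately show ?thesis
    unfolding p1_def qj l1_dist_joint_law[OF kernel_alt[OF w] k] by simp
qed

lemma p1_separated: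
  assumes w: "w \<in> sign_vectors" and L: "\<eta> \<le> L" and \<epsilon>: "\<epsilon> \<le> ennreal (\<eta> / (72 * real d))"
  shows "p1 w \<in> separated (P01 l1 l2) (Q01_TV L l1 l2) \<epsilon>"
proof -
  interpret kernel unif "alt_kernel w" by (rule kernel_alt[OF w])
  have E: "p1 w \<in> E01 l1 l2"
    unfolding p1_def by (rule joint_law_in_E01) (use set_alt_kernel[OF w] in auto)
  \<comment> \<open>The separation itself shows dependence: a member of \<open>P01\<close> would be
    at distance 0 from itself.\<close>
  have "0 < ennreal (\<eta> / (72 * real d))" using \<eta> d by simp
  then have "p1 w \<notin> P01 l1 l2"
    using p1_separation[OF w, of "p1 w"] by (auto simp: l1_dist_self)
  then have Q: "p1 w \<in> Q01 l1 l2" using E by (simp add: Q01_def)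
  have "l1_dist (alt_kernel w z) (alt_kernel w z') \<le> ennreal (L * \<bar>z - z'\<bar>)" for z z'
  proof -
    have "l1_dist (alt_kernel w z) (alt_kernel w z') = ennreal (\<Sum>v\<in>R. \<bar>pmf (alt_kernel w z) v - pmf (alt_kernel w z') v\<bar>)"
      by (rule l1_dist_pmf_finite) (use set_alt_kernel[OF w] in auto)
    \<comment> \<open>Each of the N entries has slope at most \<eta> / N, so the L1 slope is at most
      \<eta>.\<close>
    also have "\<dots> \<le> ennreal (\<Sum>v\<in>R. \<eta> * \<bar>z - z'\<bar> / N)"
    proof (intro ennreal_leI sum_mono)
      fix v assume v: "v \<in> R"
      obtain x y where xy: "v = (x, y)" by (cases v)
      have "\<bar>pmf (alt_kernel w z) v - pmf (alt_kernel w z') v\<bar> = \<bar>perturb w x y z - perturb w x y z'\<bar> / N"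
        using v N_pos by (simp add: xy pmf_alt_kernel[OF w] flip: diff_divide_distrib)
      also have "\<dots> \<le> \<eta> * \<bar>z - z'\<bar> / N"
        using N_pos by (intro divide_right_mono perturb_lipschitz[OF w]) auto
      finally show "\<bar>pmf (alt_kernel w z) v - pmf (alt_kernel w z') v\<bar> \<le> \<eta> * \<bar>z - z'\<bar> / N" .
    qed
    also have "(\<Sum>v\<in>R. \<eta> * \<bar>z - z'\<bar> / N) = \<eta> * \<bar>z - z'\<bar>" using l1 l2 by simp
    also have "ennreal \<dots> \<le> ennreal (L * \<bar>z - z'\<bar>)" using L by (intro ennreal_leI mult_right_mono) auto
    finally show ?thesis .
  qed
  then have "p1 w \<in> Q01_TV L l1 l2"
    using Q cond_version_joint_law by (auto simp: Q01_TV_def p1_def)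
  moreover have "\<epsilon> \<le> (INF q\<in>P01 l1 l2. l1_dist (p1 w) q)"
    using p1_separation[OF w] \<epsilon> by (intro INF_greatest) (auto intro: order_trans)
  ultimately show ?thesis by (simp add: separated_def)
qed

section \<open>Lower bounds on the risk and the critical radius\<close>

lemma minimax_risk_ge:
  assumes n: "(real n)\<^sup>2 \<le> N * real d ^ 5" and L: "\<eta> \<le> L"
    and H0: "p0 \<in> H0" and \<epsilon>: "\<epsilon> \<le> ennreal (\<eta> / (72 * real d))"
  shows "ennreal (1/2) \<le> minimax_risk n H0 (P01 l1 l2) (Q01_TV L l1 l2) \<epsilon>"
  unfolding minimax_risk_def
proof (rule INF_greatest)
  fix \<psi> assume \<psi>: "\<psi> \<in> tests n"
  show "ennreal (1/2) \<le> (SUP p\<in>H0. \<integral>\<^sup>+ D. ennreal (\<psi> D) \<partial>sample_law n p) +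
     (SUP p\<in>separated (P01 l1 l2) (Q01_TV L l1 l2) \<epsilon>. \<integral>\<^sup>+ D. ennreal (1 - \<psi> D) \<partial>sample_law n p)"
  proof (rule mixture_testing_bound[where ?p0.0 = p0 and W = sign_vectors and r = likelihood_ratio and \<psi> = \<psi> and n = n])
    show "prob_space p0" unfolding p0_def by (rule kernel.prob_space_joint_law[OF kernel_null])
    show "likelihood_ratio w \<in> borel_measurable p0" for w
      using likelihood_ratio_measurable by (simp add: measurable_cong_sets[OF sets_p0 refl])
    show "\<psi> \<in> borel_measurable (\<Pi>\<^sub>M i\<in>{1..n}. p0)"
      using \<psi> by (simp add: tests_def measurable_cong_sets[OF sets_PiM_cong[OF refl sets_p0] refl])
    show "\<psi> D \<in> {0..1}" for D using \<psi> by (simp add: tests_def)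
    show "(\<integral>\<^sup>+ D. ennreal (\<psi> D) \<partial>(\<Pi>\<^sub>M i\<in>{1..n}. p0)) \<le> (SUP p\<in>H0. \<integral>\<^sup>+ D. ennreal (\<psi> D) \<partial>sample_law n p)"
      by (rule SUP_upper2[OF H0]) (simp add: sample_law_def)
    show "(\<integral>\<^sup>+ D. ennreal (1 - \<psi> D) \<partial>(\<Pi>\<^sub>M i\<in>{1..n}. density p0 (likelihood_ratio w)))
        \<le> (SUP p\<in>separated (P01 l1 l2) (Q01_TV L l1 l2) \<epsilon>. \<integral>\<^sup>+ D. ennreal (1 - \<psi> D) \<partial>sample_law n p)"
      if w: "w \<in> sign_vectors" for w
      by (rule SUP_upper2[OF p1_separated[OF w L \<epsilon>]]) (simp add: sample_law_def p1_density[OF w])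
  qed (use finite_sign_vectors sign_vectors_nonempty likelihood_ratio_nonneg likelihood_ratio_integral second_moment[OF n] in auto)
qed

text \<open>Any smaller level has risk at least 1/2, above the threshold 1/3. If no level meets the
  threshold, the infimum is infinite and the bound still holds.\<close>

lemma critical_radius_ge:
  assumes "(real n)\<^sup>2 \<le> N * real d ^ 5" "\<eta> \<le> L" "p0 \<in> H0"
  shows "ennreal (\<eta> / (72 * real d)) \<le> critical_radius n H0 (P01 l1 l2) (Q01_TV L l1 l2)"
  unfolding critical_radius_def
proof (rule Inf_greatest, rule ccontr)
  fix \<epsilon> assume \<epsilon>: "\<epsilon> \<in> {\<epsilon>. minimax_risk n H0 (P01 l1 l2) (Q01_TV L l1 l2) \<epsilon> \<le> ennreal (1/3)}"
    and "\<not> ennreal (\<eta> / (72 * real d)) \<le> \<epsilon>"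
  then have "ennreal (1/2) \<le> minimax_risk n H0 (P01 l1 l2) (Q01_TV L l1 l2) \<epsilon>"
    by (intro minimax_risk_ge assms) auto
  also have "\<dots> \<le> ennreal (1/3)" using \<epsilon> by simp
  finally show False by (subst (asm) ennreal_le_iff) auto
qed

end

section \<open>Choice of the number of bins and the final rate\<close>

lemma ceiling_rate:
  fixes t :: real
  assumes "t > 0"
  obtains d :: nat where "d \<ge> 1" "t \<le> real d ^ 5" "min (t powr (-1/5)) 1 / 2 \<le> 1 / real d"
proof -
  define s where "s = t powr (1/5)"
  have s: "s > 0" using assms by (simp add: s_def)
  \<comment> \<open>The least d with t \<le> d^5. Rounding up gives d \<le> s + 1 \<le> 2 * max s 1,
    the source of both the factor 1/2 and the truncation at 1.\<close>
  define d where "d = nat \<lceil>s\<rceil>"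
  have d1: "d \<ge> 1" using s by (simp add: d_def; linarith)
  have sd: "s \<le> real d" using s by (simp add: d_def; linarith)
  have ds: "real d \<le> s + 1" using s by (simp add: d_def; linarith)
  have "t = s ^ 5" using assms by (simp add: s_def powr_powr flip: powr_realpow)
  then have "t \<le> real d ^ 5" using power_mono[OF sd, of 5] s by simp
  moreover have "min (t powr (-1/5)) 1 / 2 \<le> 1 / real d"
  proof -
    have e: "t powr (-1/5) = 1 / s" by (simp add: s_def powr_minus_divide)
    have d0: "real d > 0" using d1 by simp
    show ?thesis
    proof (cases "s \<le> 1")
      case True
      then have "real d \<le> 2" using ds by simp
      then have "1 / 2 \<le> 1 / real d" using d0 by (simp add: field_simps)
      then show ?thesis by linarith
    next
      case False
      then have "real d \<le> 2 * s" using ds by simp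
      then have "1 / s / 2 \<le> 1 / real d" using d0 s by (simp add: field_simps)
      moreover have "min (1 / s) 1 / 2 \<le> 1 / s / 2" by (intro divide_right_mono) auto
      ultimately show ?thesis unfolding e by (rule order_trans[rotated])
    qed
  qed
  ultimately show thesis using that d1 by blast
qed

theorem theorem4p1:
  fixes L :: real
    and H0 :: "nat \<Rightarrow> nat \<Rightarrow> (nat \<times> nat \<times> real) measure set"
  assumes "L > 0"
    and "H0 \<in> {P01_TV L, P01_TV2 L, P01_chi2 L}"
  shows "\<exists>c0::real. c0 > 0 \<and> (\<forall>l1 l2 n :: nat. l1 \<ge> 2 \<longrightarrow> l2 \<ge> 2 \<longrightarrow> n \<ge> 1 \<longrightarrow>
    critical_radius n (H0 l1 l2) (P01 l1 l2) (Q01_TV L l1 l2)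
      \<ge> ennreal (c0 * min (real (l1 * l2) powr (1/5) / real n powr (2/5)) 1))"
proof (intro exI conjI allI impI)
  define \<eta> where "\<eta> = min L 1"
  have \<eta>_le: "0 < \<eta>" "\<eta> \<le> 1" "\<eta> \<le> L" using assms(1) by (auto simp: \<eta>_def)
  \<comment> \<open>144 = 72 * 2: the separation constant times the loss from rounding d. It depends
    on L alone.\<close>
  then show "\<eta> / 144 > 0" by simp
  fix l1 l2 n :: nat
  assume l: "l1 \<ge> 2" "l2 \<ge> 2" and n: "n \<ge> 1"
  define N where "N = real l1 * real l2"
  \<comment> \<open>With this t the condition t \<le> d^5 is the hypothesis of the second moment
    bound, and \<open>t powr (-1/5)\<close> is the claimed rate.\<close>
  define t where "t = (real n)\<^sup>2 / N"
  have N: "N > 0" using l by (simp add: N_def)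
  have t: "t > 0" using N n by (simp add: t_def)
  obtain d where rate: "d \<ge> 1" "t \<le> real d ^ 5" "min (t powr (-1/5)) 1 / 2 \<le> 1 / real d"
    using ceiling_rate[OF t] by blast
  interpret perturbation l1 l2 d \<eta>
    by unfold_locales (use l rate(1) \<eta>_le in auto)
  have "t powr (-1/5) = N powr (1/5) / real n powr (2/5)"
  proof -
    have "(real n)\<^sup>2 powr (1/5) = (real n powr 2) powr (1/5)" using n by simp
    also have "\<dots> = real n powr (2/5)" by (simp only: powr_powr) simp
    finally show ?thesis using N n
      by (simp add: t_def powr_divide powr_powr powr_minus_divide)
  qed
  then have ge: "min (N powr (1/5) / real n powr (2/5)) 1 / 2 \<le> 1 / real d" using rate(3) by simp
  have "(real n)\<^sup>2 \<le> N * real d ^ 5" using rate(2) N by (simp add: t_def field_simps)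
  then have cr: "ennreal (\<eta> / (72 * real d)) \<le> critical_radius n (H0 l1 l2) (P01 l1 l2) (Q01_TV L l1 l2)"
    by (intro critical_radius_ge[OF _ \<eta>_le(3) p0_in_null[OF assms(2)]]) (simp add: N_def)
  have le: "\<eta> / 144 * min (N powr (1/5) / real n powr (2/5)) 1 \<le> \<eta> / (72 * real d)"
    using mult_left_mono[OF ge, of "\<eta> / 72"] \<eta>_le by simp
  then show "ennreal (\<eta> / 144 * min (real (l1 * l2) powr (1/5) / real n powr (2/5)) 1)
      \<le> critical_radius n (H0 l1 l2) (P01 l1 l2) (Q01_TV L l1 l2)"
    using order_trans[OF ennreal_leI[OF le] cr] by (simp only: N_def of_nat_mult)
qed

end
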